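(* Let $\xi$ be an extremal number with conjugates $\xi'$ and $\xi''$. Then $\nu(\xi)=\nu(\xi')=\nu(\xi'')$.
   Context: Let $\gamma=(1+\sqrt5)/2$. A real number $\xi$ is \emph{extremal} if it is neither rational nor quadratic over $\mathbb Q$ and there is a constant $c>0$ such that, for each real $X\ge 1$, the inequalities $|x_0|\le X$, $|x_0\xi-x_1|\le cX^{-1/\gamma}$, $|x_0\xi^2-x_2|\le cX^{-1/\gamma}$ admit a non-zero solution $(x_0,x_1,x_2)\in\mathbb Z^3$. The Lagrange constant of $\xi\in\mathbb R$ is $\nu(\xi)=\liminf_{q\to\infty}q\|q\xi\|$, where $\|x\|$ is the distance from the real number $x$ to a closest integer. Let $\mathcal P$ be the set of $2\times2$ integer matrices with non-zero determinant and relatively prime coefficients; it is a group under $\mathbf y_1*\mathbf y_2=c^{-1}\mathbf y_1\mathbf y_2$, where $c$ is the greatest positive common divisor of the coefficients of $\mathbf y_1\mathbf y_2$. The norm of a real matrix or vector is the largest absolute value of its coefficients. It is known that for each extremal $\xi$ there is an unbounded sequence $(\mathbf x_i)_{i\ge1}$ of symmetric matrices in $\mathcal P$ with $\|\mathbf x_{i+1}\|\asymp\|\mathbf x_i\|^\gamma$, $\|(\xi,-1)\mathbf x_i\|\asymp\|\mathbf x_i\|^{-1}$ and $|\det\mathbf x_i|\asymp1$ (implied constants independent of $i$), and a matrix $M=\begin{pmatrix}a&b\\c&d\end{pmatrix}\in\mathcal P$, neither symmetric nor skew-symmetric, such that, for each sufficiently large $i$, $\mathbf x_{i+2}=\pm\,\mathbf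 x_{i+1}*M*\mathbf x_i$ if $i$ is odd and $\mathbf x_{i+2}=\pm\,\mathbf x_{i+1}*{}^tM*\mathbf x_i$ if $i$ is even; moreover $M$ is uniquely determined by $\xi$ within the set $\{\pm M,\pm{}^tM\}$. The \emph{conjugates} of $\xi$ are $\xi'=-\frac{a+b\xi}{c+d\xi}$ and $\xi''=-\frac{a+c\xi}{b+d\xi}$; the set $\{\xi',\xi''\}$ depends only on $\xi$. *)

theory Defs
  imports
    "HOL-Analysis.Analysis"
    "HOL-Library.Landau_Symbols"
    "HOL-Computational_Algebra.Polynomial"
begin

definition golden :: real ("\<gamma>\<^sub>g") where
  "golden = (1 + sqrt 5) / 2"

definition quadratic :: "real \<Rightarrow> bool" where
  "quadratic \<xi> \<longleftrightarrow>
     (\<exists>p :: rat poly. irreducible p \<and> degree p = 2 \<and> poly (map_poly of_rat p) \<xi> = 0)"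

definition extremal :: "real \<Rightarrow> bool" where
  "extremal \<xi> \<longleftrightarrow>
     \<xi> \<notin> \<rat> \<and> \<not> quadratic \<xi> \<and>
     (\<exists>c>0. \<forall>X\<ge>1. \<exists>x0 x1 x2 :: int.
        (x0, x1, x2) \<noteq> (0, 0, 0) \<and>
        \<bar>of_int x0\<bar> \<le> X \<and>
        \<bar>of_int x0 * \<xi> - of_int x1\<bar> \<le> c * X powr (- (1 / \<gamma>\<^sub>g)) \<and>
        \<bar>of_int x0 * \<xi>\<^sup>2 - of_int x2\<bar> \<le> c * X powr (- (1 / \<gamma>\<^sub>g)))"

(* The liminf is taken in the extended reals, where it always exists; it is finite.
   infdist x \<int> is the distance from x to a closest integer. *)
definition lagrange_const :: "real \<Rightarrow> ereal" ("\<nu>") where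
  "lagrange_const \<xi> = liminf (\<lambda>q::nat. ereal (real q * infdist (real q * \<xi>) \<int>))"

type_synonym imat = "int ^ 2 ^ 2"

definition coeffs_gcd :: "imat \<Rightarrow> int" where
  "coeffs_gcd A = Gcd {A $ i $ j | i j. True}"

definition primitive_mats :: "imat set" ("\<P>") where
  "primitive_mats = {A. det A \<noteq> 0 \<and> coeffs_gcd A = 1}"

definition star_mult :: "imat \<Rightarrow> imat \<Rightarrow> imat" (infixl "\<star>" 70) where
  "A \<star> B = map_matrix (\<lambda>t. t div coeffs_gcd (A ** B)) (A ** B)"

abbreviation real_mat :: "imat \<Rightarrow> real ^ 2 ^ 2" where
  "real_mat \<equiv> map_matrix real_of_int"

(* The largest absolute value of the coefficients is the library's infnorm, for vectors as
   well as for matrices, since the standard basis of real ^ 2 ^ 2 consists of the matrix units. *)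
lemma infnorm_matrix_eq: "infnorm (A :: real ^ 'n ^ 'm) = Max {\<bar>A $ i $ j\<bar> | i j. True}"
proof -
  have "Basis = {axis i (axis j 1) :: real ^ 'n ^ 'm | i j. True}"
    by (auto simp: Basis_vec_def)
  then have "(\<lambda>b. \<bar>A \<bullet> b\<bar>) ` Basis = {\<bar>A $ i $ j\<bar> | i j. True}"
    by (force simp: inner_axis)
  then show ?thesis by (simp add: infnorm_Max)
qed

(* Comparability of sequences up to multiplicative constants is expressed with \<Theta>. It only
   constrains large indices, but all the quantities involved are positive (\<xi> is irrational and
   the matrices x i are non-singular), so it amounts to the same with constants valid for
   all i \<ge> 1. The value x 0 is irrelevant. *)
definition assoc_sequence :: "real \<Rightarrow> (nat \<Rightarrow> imat) \<Rightarrow> bool" where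
  "assoc_sequence \<xi> x \<longleftrightarrow>
     (\<forall>i\<ge>1. x i \<in> \<P> \<and> transpose (x i) = x i) \<and>
     \<not> bdd_above ((\<lambda>i. infnorm (real_mat (x i))) ` {1..}) \<and>
     (\<lambda>i. infnorm (real_mat (x (i + 1)))) \<in> \<Theta>(\<lambda>i. infnorm (real_mat (x i)) powr \<gamma>\<^sub>g) \<and>
     (\<lambda>i. infnorm (vector [\<xi>, -1] v* real_mat (x i))) \<in> \<Theta>(\<lambda>i. inverse (infnorm (real_mat (x i)))) \<and>
     (\<lambda>i. real_of_int \<bar>det (x i)\<bar>) \<in> \<Theta>(\<lambda>_. 1)"

definition assoc_matrix :: "real \<Rightarrow> imat \<Rightarrow> bool" where
  "assoc_matrix \<xi> M \<longleftrightarrow>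
     M \<in> \<P> \<and> transpose M \<noteq> M \<and> transpose M \<noteq> - M \<and>
     (\<exists>x. assoc_sequence \<xi> x \<and>
        (\<forall>\<^sub>F i in sequentially.
           (odd i \<longrightarrow> x (i + 2) = x (i + 1) \<star> M \<star> x i \<or>
                     x (i + 2) = - (x (i + 1) \<star> M \<star> x i)) \<and>
           (even i \<longrightarrow> x (i + 2) = x (i + 1) \<star> transpose M \<star> x i \<or>
                      x (i + 2) = - (x (i + 1) \<star> transpose M \<star> x i))))"

(* Replacing M by its transpose exchanges the two conjugates, and M and - M give the same ones.
   Since M is determined by \<xi> up to these changes, the relation below determines
   the unordered pair. *)
definition conjugates :: "real \<Rightarrow> real \<Rightarrow> real \<Rightarrow> bool" where
  "conjugates \<xi> \<xi>' \<xi>'' \<longleftrightarrow>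
     (\<exists>M. assoc_matrix \<xi> M \<and>
        (let a = real_of_int (M $ 1 $ 1); b = real_of_int (M $ 1 $ 2);
             c = real_of_int (M $ 2 $ 1); d = real_of_int (M $ 2 $ 2)
         in \<xi>' = - ((a + b * \<xi>) / (c + d * \<xi>)) \<and> \<xi>'' = - ((a + c * \<xi>) / (b + d * \<xi>))))"

end

theory Submission
  imports Defs
begin

text \<open>
  Write \<open>u = (1, \<xi>)\<close>. The Lagrange constant \<open>\<nu> \<eta>\<close> is the limit inferior of \<open>\<bar>q (p - \<eta> q)\<bar>\<close> over
  integer vectors \<open>(q, p)\<close> with \<open>q\<close> tending to infinity, and for good approximations this quantity is
  asymptotically the absolute value at \<open>(q, p)\<close> of any indefinite quadratic form that vanishes at
  \<open>(1, \<eta>)\<close>, suitably normalised. So one may look for matrices that preserve the lattice and carry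
  approximations to one root of a form into approximations to the other root while almost
  preserving the value of the form.

  Let \<open>x\<^sub>i\<close> be the symmetric matrices attached to \<open>\<xi>\<close>, and let \<open>G\<close> be \<open>M\<close> or its transpose,
  according to the parity of \<open>i\<close>, so that \<open>x\<^sub>i\<^sub>+\<^sub>2\<close> is proportional to \<open>x\<^sub>i\<^sub>+\<^sub>1 G x\<^sub>i\<close>. Such an
  \<open>x\<^sub>i\<close> maps almost everything close to the line of \<open>u\<close>, its inverse maps almost everything close
  to the line of \<open>(-\<xi>, 1)\<close>, and the recurrence shows that \<open>x\<^sub>i\<^sup>-\<^sup>1 u\<close> has direction
  close to \<open>G\<^sup>t u\<close> (lemma \<open>adjugate_limit\<close>). Consequently \<open>x\<^sub>j\<^sup>-\<^sup>1 x\<^sub>i\<close>, with \<open>i\<close> large and \<open>j\<close>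
  much larger and of the same parity, carries vectors near the line of \<open>G\<^sup>t u\<close> to vectors near the line of
  \<open>(-\<xi>, 1)\<close>, and almost preserves the values of the form that vanishes on these two lines. The
  determinants are bounded but need not be units; however, if \<open>x\<^sub>i\<close> and \<open>x\<^sub>j\<close> have the same
  determinant \<open>D\<close> and are congruent modulo \<open>D N\<close>, then \<open>x\<^sub>j\<^sup>-\<^sup>1 x\<^sub>i\<close> is an integer matrix congruent
  to \<open>1\<close> modulo \<open>N\<close>, and preserves any given lattice \<open>B \<int>\<^sup>2\<close> with \<open>det B = N\<close>. By the
  pigeonhole principle this happens for infinitely many indices of each parity
  (lemma \<open>congruent_subsequence\<close>). In coordinates with respect to \<open>B\<close> this gives
  \<open>\<nu> \<eta> \<le> \<nu> \<eta>'\<close> whenever \<open>B (1, \<eta>)\<close> is parallel to \<open>(-\<xi>, 1)\<close> and \<open>B (1, \<eta>')\<close> to \<open>G\<^sup>t u\<close>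
  (lemma \<open>approximation_transfer\<close>).

  If \<open>B\<close> is the rotation by a right angle, then \<open>\<eta> = \<xi>\<close> and \<open>\<eta>'\<close> is one of the conjugates; if
  \<open>B = G\<^sup>t\<close>, then \<open>\<eta>' = \<xi>\<close> and \<open>\<eta>\<close> is the other conjugate. Taking both values of \<open>G\<close>
  yields all inequalities between \<open>\<nu> \<xi>\<close> and \<open>\<nu> \<xi>'\<close>, \<open>\<nu> \<xi>''\<close>. The assumptions that \<open>\<xi>\<close> is not
  quadratic and that \<open>M\<close> is not skew-symmetric enter through \<open>u \<bullet> G\<^sup>t u \<noteq> 0\<close>, which
  keeps the lines of \<open>G\<^sup>t u\<close> and \<open>(-\<xi>, 1)\<close> apart.
\<close>

section \<open>Linear and quadratic relations over the integers\<close>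

lemma irrational_affine_ne_zero:
  assumes "\<xi> \<notin> \<rat>" "p \<noteq> 0 \<or> q \<noteq> 0"
  shows "of_int p + of_int q * \<xi> \<noteq> (0 :: real)"
proof
  assume eq: "of_int p + of_int q * \<xi> = 0"
  show False
  proof (cases "q = 0")
    case False
    then have "\<xi> = - of_int p / of_int q"
      using eq by (simp add: field_simps add_eq_0_iff)
    with assms(1) show False by simp
  qed (use eq assms(2) in auto)
qed

lemma quadratic_relation_zero:
  fixes A B C :: int
  assumes "\<xi> \<notin> \<rat>" "\<not> quadratic \<xi>"
    and rel: "of_int A + of_int B * \<xi> + of_int C * \<xi>\<^sup>2 = 0"
  shows "A = 0 \<and> B = 0 \<and> C = 0"
proof -
  have linear: "v = 0" if "of_rat u + of_rat v * \<xi> = 0" for u v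
  proof (rule ccontr)
    assume "v \<noteq> 0"
    then have "\<xi> = of_rat (- u / v)"
      using that by (simp add: of_rat_divide of_rat_minus field_simps add_eq_0_iff)
    with assms(1) show False by simp
  qed
  have degree_one: "\<exists>u v. a = [:u, v:] \<and> v \<noteq> 0" if "degree a = 1" for a :: "rat poly"
  proof -
    obtain u a' where a: "a = pCons u a'"
      by (cases a)
    with that have "degree a' = 0" "a' \<noteq> 0"
      by (auto split: if_splits)
    with a show ?thesis
      by (metis degree_eq_zeroE pCons_0_0)
  qed
  have "C = 0"
  proof (rule ccontr)
    assume "C \<noteq> 0"
    define p :: "rat poly" where "p = [:of_int A, of_int B, of_int C:]"
    have deg: "degree p = 2"
      using \<open>C \<noteq> 0\<close> by (simp add: p_def)
    have "irreducible p"
    proof (rule irreducibleI)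
      show "p \<noteq> 0" using deg by auto
      show "\<not> is_unit p" using deg by (simp add: is_unit_iff_degree \<open>p \<noteq> 0\<close>)
      fix a b assume ab: "p = a * b"
      show "is_unit a \<or> is_unit b"
      proof (rule ccontr)
        assume "\<not> ?thesis"
        moreover have "a \<noteq> 0" "b \<noteq> 0"
          using \<open>p \<noteq> 0\<close> ab by auto
        ultimately have "degree a = 1" "degree b = 1"
          using deg unfolding ab by (simp_all add: is_unit_iff_degree degree_mult_eq)
        then obtain a0 a1 b0 b1 where "a = [:a0, a1:]" "a1 \<noteq> 0" "b = [:b0, b1:]" "b1 \<noteq> 0"
          using degree_one by metis
        moreover from this have "of_int A = a0 * b0" "of_int B = a0 * b1 + a1 * b0" "of_int C = a1 * b1"
          using ab by (simp_all add: p_def)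
        then have "real_of_int A = of_rat (a0 * b0)" "real_of_int B = of_rat (a0 * b1 + a1 * b0)"
          "real_of_int C = of_rat (a1 * b1)"
          by (metis of_rat_of_int_eq)+
        then have "(of_rat a0 + of_rat a1 * \<xi>) * (of_rat b0 + of_rat b1 * \<xi>) = 0"
          using rel by (simp add: of_rat_mult of_rat_add algebra_simps power2_eq_square)
        ultimately show False
          using linear by (metis mult_eq_0_iff)
      qed
    qed
    moreover have "poly (map_poly of_rat p) \<xi> = 0"
      using rel by (simp add: p_def map_poly_pCons algebra_simps power2_eq_square)
    ultimately show False
      using assms(2) deg unfolding quadratic_def by blast
  qed
  with rel irrational_affine_ne_zero[OF assms(1), of A B] show ?thesis
    by auto
qed

section \<open>Lagrange constants and rational approximations\<close>

lemma lagrange_const_lessD: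
  assumes "\<nu> \<eta> < ereal r"
  shows "\<exists>\<^sub>F q in sequentially. \<exists>p::int. real q * \<bar>real q * \<eta> - of_int p\<bar> < r"
proof -
  have "\<exists>\<^sub>F q in sequentially. real q * infdist (real q * \<eta>) \<int> < r"
  proof (rule ccontr)
    assume "\<not> ?thesis"
    then have "\<forall>\<^sub>F q in sequentially. ereal r \<le> ereal (real q * infdist (real q * \<eta>) \<int>)"
      by (simp add: not_frequently not_less)
    then have "ereal r \<le> \<nu> \<eta>"
      unfolding lagrange_const_def by (rule Liminf_bounded)
    with assms show False by simp
  qed
  then show ?thesis
  proof (rule frequently_elim1)
    fix q :: nat
    assume "real q * infdist (real q * \<eta>) \<int> < r"
    moreover obtain y where "y \<in> \<int>" "infdist (real q * \<eta>) \<int> = dist (real q * \<eta>) y"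
      using infdist_attains_inf[of "\<int> :: real set"] by (metis Ints_0 closed_Ints empty_iff)
    ultimately show "\<exists>p::int. real q * \<bar>real q * \<eta> - of_int p\<bar> < r"
      by (auto elim!: Ints_cases simp: dist_real_def)
  qed
qed

text \<open>The denominators may be negative here, since changing the sign of both \<^term>\<open>q\<close> and
  \<^term>\<open>p\<close> does not affect the approximation.\<close>

lemma lagrange_const_leI:
  assumes "\<And>K. \<exists>q p :: int. \<bar>q\<bar> \<ge> K \<and> \<bar>of_int q * (of_int p - \<eta> * of_int q)\<bar> \<le> r"
  shows "\<nu> \<eta> \<le> ereal r"
proof (rule ccontr)
  assume "\<not> ?thesis"
  then have "\<forall>\<^sub>F q in sequentially. ereal r < ereal (real q * infdist (real q * \<eta>) \<int>)"
    unfolding lagrange_const_def not_le by (rule less_LiminfD)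
  then obtain Q where Q: "\<And>q. q \<ge> Q \<Longrightarrow> r < real q * infdist (real q * \<eta>) \<int>"
    by (auto simp: eventually_sequentially)
  obtain q p :: int where qp: "\<bar>q\<bar> \<ge> int Q" "\<bar>of_int q * (of_int p - \<eta> * of_int q)\<bar> \<le> r"
    using assms[of "int Q"] by blast
  define n where "n = nat \<bar>q\<bar>"
  define p' where "p' = (if q \<ge> 0 then p else - p)"
  have "\<bar>real n * \<eta> - of_int p'\<bar> = \<bar>of_int p - \<eta> * of_int q\<bar>"
    by (auto simp: n_def p'_def abs_if algebra_simps)
  moreover have "infdist (real n * \<eta>) \<int> \<le> \<bar>real n * \<eta> - of_int p'\<bar>"
    using infdist_le[of "of_int p'" "\<int>" "real n * \<eta>"] by (simp add: dist_real_def)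
  moreover have "real n = \<bar>of_int q\<bar>"
    by (simp add: n_def)
  ultimately have "real n * infdist (real n * \<eta>) \<int> \<le> \<bar>of_int q * (of_int p - \<eta> * of_int q)\<bar>"
    by (simp add: abs_mult mult_left_mono)
  moreover have "n \<ge> Q"
    using qp(1) by (simp add: n_def)
  ultimately show False
    using Q[of n] qp(2) by linarith
qed

section \<open>Transfer of approximations by symmetric matrices\<close>

text \<open>
  A fixed integer vector \<open>y\<close> is moved by the matrices \<open>adj(x\<^sub>k) / D\<close>, where \<open>x\<^sub>k\<close> is the
  symmetric matrix with rows \<open>(x0 k, x1 k)\<close> and \<open>(x1 k, x2 k)\<close> and determinant \<open>D\<close>. The result
  \<open>B (Q k, P k)\<close> runs off to infinity along the line spanned by \<open>(-\<xi>, 1)\<close>, which is the line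
  spanned by \<open>B (1, \<eta>)\<close>. The limit is a binary quadratic form in \<open>y\<close>, which has the root
  \<open>(1, \<xi>)\<close>; the hypotheses on \<open>m1\<close> and \<open>m2\<close> say that \<open>x0 k\<close> times the vector
  \<open>adj(x\<^sub>k) (1, \<xi>)\<close> converges to \<open>D (m1, m2)\<close>.
\<close>

lemma moved_approximation_limit:
  fixes \<xi> \<eta> m1 m2 :: real and x0 x1 x2 Q P :: "nat \<Rightarrow> int" and D b11 b12 b21 b22 y1 y2 :: int
  assumes "D \<noteq> 0"
    and x0: "filterlim (\<lambda>k. \<bar>real_of_int (x0 k)\<bar>) at_top sequentially"
    and ratio: "(\<lambda>k. of_int (x1 k) / of_int (x0 k)) \<longlonglongrightarrow> \<xi>"
    and m1: "(\<lambda>k. of_int (x0 k) * (of_int (x2 k) - \<xi> * of_int (x1 k))) \<longlonglongrightarrow> of_int D * m1"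
    and m2: "(\<lambda>k. of_int (x0 k) * (\<xi> * of_int (x0 k) - of_int (x1 k))) \<longlonglongrightarrow> of_int D * m2"
    and b: "b11 * b22 - b12 * b21 \<noteq> 0"
    and \<eta>: "of_int b11 + of_int b12 * \<eta> = - \<xi> * (of_int b21 + of_int b22 * \<eta>)"
    and QP1: "\<And>k. D * (b11 * Q k + b12 * P k) = x2 k * y1 - x1 k * y2"
    and QP2: "\<And>k. D * (b21 * Q k + b22 * P k) = x0 k * y2 - x1 k * y1"
    and L: "of_int y2 - \<xi> * of_int y1 \<noteq> 0"
  shows "filterlim (\<lambda>k. \<bar>real_of_int (Q k)\<bar>) at_top sequentially"
    and "(\<lambda>k. of_int (Q k) * (of_int (P k) - \<eta> * of_int (Q k))) \<longlonglongrightarrow>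
           - ((of_int y2 - \<xi> * of_int y1) * (m1 * of_int y1 + m2 * of_int y2) /
              (of_int D * of_int (b11 * b22 - b12 * b21)))"
proof -
  let ?L = "of_int y2 - \<xi> * of_int y1"
  define e where "e = of_int b21 + of_int b22 * \<eta>"
  define h where "h = of_int b12 + \<xi> * of_int b22"
  \<comment> \<open>\<open>Z k\<close> is the second coordinate of the moved vector and \<open>W k\<close> its product with \<open>(1, \<xi>)\<close>.
      As \<open>Z\<close> tends to infinity while \<open>Z W\<close> converges, the two together determine the limit of
      \<open>Q (P - \<eta> Q)\<close>.\<close>
  define Z where "Z k = real_of_int (b21 * Q k + b22 * P k)" for k
  define W where "W k = real_of_int (b11 * Q k + b12 * P k) + \<xi> * Z k" for k
  define \<delta> where "\<delta> k = of_int (P k) - \<eta> * of_int (Q k)" for k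
  have b_eq: "real_of_int (b11 * b22 - b12 * b21) = - (e * h)"
  proof -
    have "B11 * B22 - B12 * B21 = - ((B21 + B22 * \<eta>) * (B12 + \<xi> * B22))"
      if "B11 + B12 * \<eta> = - \<xi> * (B21 + B22 * \<eta>)" for B11 B12 B21 B22 :: real
      using that by algebra
    from this[OF \<eta>] show ?thesis
      by (simp add: e_def h_def)
  qed
  have e0: "e \<noteq> 0" and h0: "h \<noteq> 0"
    using b b_eq by (metis mult_zero_left mult_zero_right neg_0_equal_iff_equal of_int_eq_0_iff)+
  have W_eq: "W k = \<delta> k * h" for k
  proof -
    have "B11 * q + B12 * p + \<xi> * (B21 * q + B22 * p) = (p - \<eta> * q) * (B12 + \<xi> * B22)"
      if "B11 + B12 * \<eta> = - \<xi> * (B21 + B22 * \<eta>)" for B11 B12 B21 B22 p q :: real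
      using that by algebra
    from this[OF \<eta>] show ?thesis
      by (simp add: W_def Z_def \<delta>_def h_def)
  qed
  have Z_eq: "Z k = of_int (Q k) * e + \<delta> k * of_int b22" for k
    by (simp add: Z_def \<delta>_def e_def algebra_simps)
  have Z_D: "of_int D * Z k = of_int (x0 k) * of_int y2 - of_int (x1 k) * of_int y1" for k
    unfolding Z_def using arg_cong[OF QP2[of k], of real_of_int] by simp
  have W_D: "of_int D * W k = (of_int (x2 k) - \<xi> * of_int (x1 k)) * of_int y1
               + (\<xi> * of_int (x0 k) - of_int (x1 k)) * of_int y2" for k
  proof -
    have "of_int D * real_of_int (b11 * Q k + b12 * P k) = of_int (x2 k) * of_int y1 - of_int (x1 k) * of_int y2"
      using arg_cong[OF QP1[of k], of real_of_int] by simp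
    moreover have "of_int D * W k = of_int D * real_of_int (b11 * Q k + b12 * P k) + \<xi> * (of_int D * Z k)"
      by (simp only: W_def) (simp only: distrib_left mult.left_commute)
    ultimately show ?thesis
      using Z_D[of k] by (simp add: algebra_simps)
  qed
  have x0_ne: "\<forall>\<^sub>F k in sequentially. x0 k \<noteq> 0"
    using x0[unfolded filterlim_at_top, rule_format, of 1] by eventually_elim auto
  let ?g = "\<lambda>k. (of_int y2 - of_int (x1 k) / of_int (x0 k) * of_int y1) / of_int D"
  have g: "?g \<longlonglongrightarrow> ?L / of_int D"
    by (intro tendsto_intros ratio) (use \<open>D \<noteq> 0\<close> in auto)
  have Z_g: "Z k = of_int (x0 k) * ?g k" if "x0 k \<noteq> 0" for k
  proof -
    have "Z k = (of_int (x0 k) * of_int y2 - of_int (x1 k) * of_int y1) / of_int D"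
      using Z_D[of k] \<open>D \<noteq> 0\<close> by (simp add: field_simps)
    also have "\<dots> = of_int (x0 k) * ?g k"
      using that by (simp add: right_diff_distrib)
    finally show ?thesis .
  qed
  have ZW: "(\<lambda>k. Z k * W k) \<longlonglongrightarrow> ?L / of_int D * (m1 * of_int y1 + m2 * of_int y2)"
  proof -
    have "(\<lambda>k. ?g k * ((of_int (x0 k) * (of_int (x2 k) - \<xi> * of_int (x1 k))) * of_int y1
            + (of_int (x0 k) * (\<xi> * of_int (x0 k) - of_int (x1 k))) * of_int y2) / of_int D)
          \<longlonglongrightarrow> ?L / of_int D * ((of_int D * m1) * of_int y1 + (of_int D * m2) * of_int y2) / of_int D"
      by (intro tendsto_intros g m1 m2) (use \<open>D \<noteq> 0\<close> in auto)
    moreover have "\<forall>\<^sub>F k in sequentially. ?g k * ((of_int (x0 k) * (of_int (x2 k) - \<xi> * of_int (x1 k))) * of_int y1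
            + (of_int (x0 k) * (\<xi> * of_int (x0 k) - of_int (x1 k))) * of_int y2) / of_int D = Z k * W k"
      using x0_ne
    proof eventually_elim
      case (elim k)
      have W: "W k = ((of_int (x2 k) - \<xi> * of_int (x1 k)) * of_int y1
               + (\<xi> * of_int (x0 k) - of_int (x1 k)) * of_int y2) / of_int D"
        using W_D[of k] \<open>D \<noteq> 0\<close> by (simp add: field_simps)
      have "g * ((x * A) * s + (x * B) * u) / d = (x * g) * ((A * s + B * u) / d)" for g x A B s u d :: real
        by (simp add: distrib_left mult.assoc mult.left_commute)
      then show ?case
        unfolding Z_g[OF elim] W by blast
    qed
    ultimately have "(\<lambda>k. Z k * W k) \<longlonglongrightarrow>
        ?L / of_int D * ((of_int D * m1) * of_int y1 + (of_int D * m2) * of_int y2) / of_int D"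
      by (rule Lim_transform_eventually)
    moreover have "(of_int D * m1) * of_int y1 + (of_int D * m2) * of_int y2
                   = of_int D * (m1 * of_int y1 + m2 * of_int y2)"
      by (simp add: algebra_simps)
    ultimately show ?thesis
      using \<open>D \<noteq> 0\<close> by simp
  qed
  have Z_top: "filterlim (\<lambda>k. \<bar>Z k\<bar>) at_top sequentially"
  proof -
    have "filterlim (\<lambda>k. \<bar>?g k\<bar> * \<bar>real_of_int (x0 k)\<bar>) at_top sequentially"
      by (rule filterlim_tendsto_pos_mult_at_top[OF tendsto_rabs[OF g] _ x0]) (use L \<open>D \<noteq> 0\<close> in auto)
    moreover have "\<forall>\<^sub>F k in sequentially. \<bar>?g k\<bar> * \<bar>real_of_int (x0 k)\<bar> = \<bar>Z k\<bar>"
      using x0_ne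
    proof eventually_elim
      case (elim k)
      show ?case
        unfolding Z_g[OF elim] by (simp only: abs_mult mult.commute)
    qed
    ultimately show ?thesis
      by (rule filterlim_mono_eventually[OF _ order_refl order_refl])
  qed
  have "(\<lambda>k. (Z k * W k) / Z k) \<longlonglongrightarrow> 0"
    by (rule tendsto_divide_0[OF ZW]) (use Z_top in \<open>simp add: filterlim_at_infinity_conv_norm_at_top\<close>)
  moreover have "\<forall>\<^sub>F k in sequentially. (Z k * W k) / Z k = W k"
    using Z_top[unfolded filterlim_at_top, rule_format, of 1] by eventually_elim auto
  ultimately have W0: "W \<longlonglongrightarrow> 0"
    by (rule Lim_transform_eventually)
  have \<delta>_W: "\<delta> = (\<lambda>k. W k / h)"
    using W_eq h0 by auto
  have \<delta>0: "\<delta> \<longlonglongrightarrow> 0"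
    unfolding \<delta>_W using tendsto_divide[OF W0 tendsto_const[of h]] h0 by simp
  have Q_eq: "real_of_int (Q k) = (Z k - \<delta> k * of_int b22) / e" for k
    using Z_eq[of k] e0 by (simp add: field_simps)
  have "filterlim (\<lambda>k. (1 / \<bar>e\<bar>) * (- \<bar>\<delta> k * of_int b22\<bar> + \<bar>Z k\<bar>)) at_top sequentially"
    by (rule filterlim_tendsto_pos_mult_at_top[OF tendsto_const])
       (use e0 in simp, rule filterlim_tendsto_add_at_top[OF _ Z_top],
        rule tendsto_minus, rule tendsto_rabs, rule tendsto_mult[OF \<delta>0 tendsto_const])
  then show "filterlim (\<lambda>k. \<bar>real_of_int (Q k)\<bar>) at_top sequentially"
  proof (rule filterlim_at_top_mono, intro always_eventually allI)
    fix k
    have "(1 / \<bar>e\<bar>) * (- \<bar>\<delta> k * of_int b22\<bar> + \<bar>Z k\<bar>) \<le> (1 / \<bar>e\<bar>) * \<bar>Z k - \<delta> k * of_int b22\<bar>"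
      by (rule mult_left_mono) auto
    then show "(1 / \<bar>e\<bar>) * (- \<bar>\<delta> k * of_int b22\<bar> + \<bar>Z k\<bar>) \<le> \<bar>real_of_int (Q k)\<bar>"
      unfolding Q_eq by (simp add: abs_divide)
  qed
  have "(\<lambda>k. (Z k * W k) / (e * h) - \<delta> k * \<delta> k * of_int b22 / e) \<longlonglongrightarrow>
     (?L / of_int D * (m1 * of_int y1 + m2 * of_int y2)) / (e * h) - 0 * 0 * of_int b22 / e"
    by (intro tendsto_intros ZW \<delta>0) (use e0 h0 in auto)
  moreover have "(Z k * W k) / (e * h) - \<delta> k * \<delta> k * of_int b22 / e = of_int (Q k) * \<delta> k" for k
    unfolding Q_eq W_eq using e0 h0 by (simp add: field_simps)
  ultimately have "(\<lambda>k. of_int (Q k) * \<delta> k) \<longlonglongrightarrow>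
      (?L / of_int D * (m1 * of_int y1 + m2 * of_int y2)) / (e * h)"
    by simp
  then show "(\<lambda>k. of_int (Q k) * (of_int (P k) - \<eta> * of_int (Q k))) \<longlonglongrightarrow>
           - ((of_int y2 - \<xi> * of_int y1) * (m1 * of_int y1 + m2 * of_int y2) /
              (of_int D * of_int (b11 * b22 - b12 * b21)))"
    unfolding b_eq \<delta>_def by simp
qed

text \<open>
  The transfer of approximations. Put \<open>u = (1, \<xi>)\<close>, \<open>m = (m1, m2)\<close> and let \<open>x\<^sub>k\<close> be the symmetric
  matrices as above. If \<open>(q, p)\<close> is a good approximation to \<open>\<eta>'\<close>, then \<open>z = B (q, p)\<close> is close to
  the line of \<open>m\<close>, the vector \<open>y = x\<^sub>k z\<close> is close to the line of \<open>u\<close>, and \<open>adj(x\<^sub>l) y / D\<close>, with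
  \<open>l\<close> far beyond \<open>k\<close>, is close to the line of \<open>(-\<xi>, 1)\<close>. The congruences ensure that the last vector
  is again of the form \<open>B (q', p')\<close> with integers \<open>q'\<close>, \<open>p'\<close>, so that \<open>(q', p')\<close> approximates
  \<open>\<eta>\<close>. Letting first \<open>l\<close> and then \<open>k\<close> tend to infinity, \<open>q' (p' - \<eta> q')\<close> converges, up to
  sign, to \<open>F(z) / det B\<close>, where \<open>F(z) = (u \<bullet> z) (m1 z2 - m2 z1)\<close> is the quadratic form whose
  roots are the lines of \<open>(-\<xi>, 1)\<close> and \<open>m\<close>; and \<open>F(z) / det B\<close> differs little from
  \<open>q (p - \<eta>' q)\<close>.
\<close>

lemma approximation_transfer:
  fixes \<xi> \<eta> \<eta>' m1 m2 :: real and x0 x1 x2 :: "nat \<Rightarrow> int" and D b11 b12 b21 b22 :: int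
  assumes irr: "\<xi> \<notin> \<rat>"
    and "D \<noteq> 0"
    and det: "\<And>k. x0 k * x2 k - x1 k * x1 k = D"
    and cong: "\<And>k l. D * (b11 * b22 - b12 * b21) dvd x0 k - x0 l"
      "\<And>k l. D * (b11 * b22 - b12 * b21) dvd x1 k - x1 l"
      "\<And>k l. D * (b11 * b22 - b12 * b21) dvd x2 k - x2 l"
    and x0: "filterlim (\<lambda>k. \<bar>real_of_int (x0 k)\<bar>) at_top sequentially"
    and ratio: "(\<lambda>k. of_int (x1 k) / of_int (x0 k)) \<longlonglongrightarrow> \<xi>"
    and m1: "(\<lambda>k. of_int (x0 k) * (of_int (x2 k) - \<xi> * of_int (x1 k))) \<longlonglongrightarrow> of_int D * m1"
    and m2: "(\<lambda>k. of_int (x0 k) * (\<xi> * of_int (x0 k) - of_int (x1 k))) \<longlonglongrightarrow> of_int D * m2"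
    and m: "m1 + \<xi> * m2 = 1"
    and b: "b11 * b22 - b12 * b21 \<noteq> 0"
    and \<eta>: "of_int b11 + of_int b12 * \<eta> = - \<xi> * (of_int b21 + of_int b22 * \<eta>)"
    and \<eta>': "(of_int b11 + of_int b12 * \<eta>') * m2 = (of_int b21 + of_int b22 * \<eta>') * m1"
  shows "\<nu> \<eta> \<le> \<nu> \<eta>'"
proof (rule ccontr)
  assume "\<not> ?thesis"
  then obtain r' where r': "\<nu> \<eta>' < ereal r'" "ereal r' < \<nu> \<eta>"
    using ereal_dense2 by (metis not_le)
  then obtain r where r: "\<nu> \<eta>' < ereal r" "r < r'"
    using ereal_dense2 by (metis less_ereal.simps(1))
  let ?b = "b11 * b22 - b12 * b21"
  define v1 v2 where "v1 = of_int b11 + of_int b12 * \<eta>'" and "v2 = of_int b21 + of_int b22 * \<eta>'"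
  define t where "t = v1 + \<xi> * v2"
  define \<kappa> where "\<kappa> = (of_int b12 + \<xi> * of_int b22) / t"
  have b_eq: "real_of_int ?b = v1 * of_int b22 - v2 * of_int b12"
    by (simp add: v1_def v2_def algebra_simps)
  have v1: "v1 = t * m1" and v2: "v2 = t * m2"
    using \<eta>' m unfolding t_def v1_def[symmetric] v2_def[symmetric] by algebra+
  have t0: "t \<noteq> 0"
    using b b_eq v1 v2 by (metis diff_self mult_zero_left of_int_eq_0_iff)

  \<comment> \<open>\<open>\<kappa>\<close> measures the deviation of \<open>F(z) / det B\<close> from \<open>q (p - \<eta>' q)\<close>; it is harmless for
      large \<open>q\<close>.\<close>
  have "\<forall>\<^sub>F q in sequentially. q > 0 \<and> \<bar>\<kappa>\<bar> * (r / real q)\<^sup>2 < r' - r"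
  proof -
    have "(\<lambda>q. \<bar>\<kappa>\<bar> * (r / real q)\<^sup>2) \<longlonglongrightarrow> \<bar>\<kappa>\<bar> * 0\<^sup>2"
      by (intro tendsto_intros lim_const_over_n)
    then have "\<forall>\<^sub>F q in sequentially. \<bar>\<kappa>\<bar> * (r / real q)\<^sup>2 < r' - r"
      using r by (intro order_tendstoD(2)) auto
    with eventually_gt_at_top[of 0] show ?thesis
      by eventually_elim auto
  qed
  from frequently_eventually_conj[OF lagrange_const_lessD[OF r(1)] this]
  obtain q p where q: "q > 0" "\<bar>\<kappa>\<bar> * (r / real q)\<^sup>2 < r' - r"
    and qp: "real q * \<bar>real q * \<eta>' - of_int p\<bar> < r"
    by (auto dest!: frequently_ex)
  define \<delta> where "\<delta> = of_int p - \<eta>' * real q"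
  define z1 z2 where "z1 = b11 * int q + b12 * p" and "z2 = b21 * int q + b22 * p"
  have z1: "real_of_int z1 = real q * v1 + \<delta> * of_int b12"
    and z2: "real_of_int z2 = real q * v2 + \<delta> * of_int b22"
    by (simp_all add: z1_def z2_def v1_def v2_def \<delta>_def algebra_simps)
  have z_ne: "z1 \<noteq> 0 \<or> z2 \<noteq> 0"
  proof (rule ccontr)
    assume "\<not> ?thesis"
    then have "?b * int q = b22 * 0 - b12 * 0"
      unfolding z1_def z2_def by algebra
    with b q show False by simp
  qed
  define F where "F = (of_int z1 + \<xi> * of_int z2) * (m1 * of_int z2 - m2 * of_int z1)"
  have F: "F / of_int ?b = \<delta> * (real q + \<delta> * \<kappa>)"
  proof -
    have "t * (m1 * of_int z2 - m2 * of_int z1) = \<delta> * of_int ?b"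
      unfolding b_eq z1 z2 unfolding v1 v2 by (simp add: algebra_simps)
    then have 1: "m1 * of_int z2 - m2 * of_int z1 = \<delta> * of_int ?b / t"
      using t0 by (simp add: field_simps)
    have 2: "of_int z1 + \<xi> * of_int z2 = t * (real q + \<delta> * \<kappa>)"
      unfolding z1 z2 \<kappa>_def using t0 by (simp add: t_def field_simps)
    show ?thesis
      unfolding F_def 1 2 using t0 b by (simp del: of_int_diff of_int_mult)
  qed
  have F_less: "\<bar>F / of_int ?b\<bar> < r'"
  proof -
    have d: "real q * \<bar>\<delta>\<bar> < r"
      using qp by (simp add: \<delta>_def abs_minus_commute mult.commute)
    have "\<bar>\<delta>\<bar> \<le> r / real q"
      using d q(1) by (simp add: field_simps)
    then have "\<bar>\<delta>\<bar>\<^sup>2 \<le> (r / real q)\<^sup>2"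
      by (intro power_mono) auto
    then have "\<bar>\<kappa>\<bar> * \<bar>\<delta>\<bar>\<^sup>2 \<le> \<bar>\<kappa>\<bar> * (r / real q)\<^sup>2"
      by (intro mult_left_mono) auto
    moreover have "\<bar>\<delta> * (real q + \<delta> * \<kappa>)\<bar> \<le> real q * \<bar>\<delta>\<bar> + \<bar>\<kappa>\<bar> * \<bar>\<delta>\<bar>\<^sup>2"
      using abs_triangle_ineq[of "\<delta> * real q" "\<delta> * (\<delta> * \<kappa>)"]
      by (simp add: distrib_left abs_mult power2_eq_square mult.commute mult.left_commute)
    ultimately show ?thesis
      unfolding F using d q(2) by linarith
  qed

  define y1 y2 where "y1 k = x0 k * z1 + x1 k * z2" and "y2 k = x1 k * z1 + x2 k * z2" for k
  define V where "V k = (of_int (y2 k) - \<xi> * of_int (y1 k)) * (m1 * of_int (y1 k) + m2 * of_int (y2 k))" for k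
  have x0_ne: "\<forall>\<^sub>F k in sequentially. x0 k \<noteq> 0"
    using x0[unfolded filterlim_at_top, rule_format, of 1] by eventually_elim auto
  have "V \<longlonglongrightarrow> of_int D * F"
  proof -
    have inv: "(\<lambda>k. inverse (of_int (x0 k)) :: real) \<longlonglongrightarrow> 0"
      using x0 by (intro tendsto_inverse_0[THEN filterlim_compose]) (simp add: filterlim_at_infinity_conv_norm_at_top)
    let ?A = "\<lambda>k. of_int (x0 k) * (of_int (x2 k) - \<xi> * of_int (x1 k))"
    let ?B = "\<lambda>k. of_int (x0 k) * (\<xi> * of_int (x0 k) - of_int (x1 k))"
    let ?R = "\<lambda>k. of_int (x1 k) / of_int (x0 k) :: real"
    let ?I = "\<lambda>k. inverse (of_int (x0 k)) :: real"
    have "(\<lambda>k. (?A k * of_int z2 - ?B k * of_int z1) *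
           (m1 * (of_int z1 + ?R k * of_int z2) + m2 * (?R k * of_int z1 + (?A k * ?I k * ?I k + \<xi> * ?R k) * of_int z2)))
       \<longlonglongrightarrow> (of_int D * m1 * of_int z2 - of_int D * m2 * of_int z1) *
           (m1 * (of_int z1 + \<xi> * of_int z2) + m2 * (\<xi> * of_int z1 + (of_int D * m1 * 0 * 0 + \<xi> * \<xi>) * of_int z2))"
      by (intro tendsto_intros m1 m2 ratio inv)
    also have "(of_int D * m1 * of_int z2 - of_int D * m2 * of_int z1) *
           (m1 * (of_int z1 + \<xi> * of_int z2) + m2 * (\<xi> * of_int z1 + (of_int D * m1 * 0 * 0 + \<xi> * \<xi>) * of_int z2))
         = of_int D * F * (m1 + \<xi> * m2)"
      unfolding F_def by (simp add: algebra_simps)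
    finally have "(\<lambda>k. (?A k * of_int z2 - ?B k * of_int z1) *
           (m1 * (of_int z1 + ?R k * of_int z2) + m2 * (?R k * of_int z1 + (?A k * ?I k * ?I k + \<xi> * ?R k) * of_int z2)))
       \<longlonglongrightarrow> of_int D * F * (m1 + \<xi> * m2)" .
    then have "V \<longlonglongrightarrow> of_int D * F * (m1 + \<xi> * m2)"
    proof (rule Lim_transform_eventually)
      show "\<forall>\<^sub>F k in sequentially. (?A k * of_int z2 - ?B k * of_int z1) *
           (m1 * (of_int z1 + ?R k * of_int z2) + m2 * (?R k * of_int z1 + (?A k * ?I k * ?I k + \<xi> * ?R k) * of_int z2)) = V k"
      using x0_ne
    proof eventually_elim
      case (elim k)
      have "of_int (y2 k) - \<xi> * of_int (y1 k) = (?A k * of_int z2 - ?B k * of_int z1) / of_int (x0 k)"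
        using elim by (simp add: y1_def y2_def field_simps)
      moreover have "m1 * of_int (y1 k) + m2 * of_int (y2 k) = of_int (x0 k) *
          (m1 * (of_int z1 + ?R k * of_int z2) + m2 * (?R k * of_int z1 + (?A k * ?I k * ?I k + \<xi> * ?R k) * of_int z2))"
        using elim by (simp add: y1_def y2_def field_simps)
      ultimately show ?case
        unfolding V_def using elim by simp
    qed
    qed
    then show ?thesis
      by (simp add: m)
  qed
  then have "(\<lambda>k. \<bar>V k / (of_int D * of_int ?b)\<bar>) \<longlonglongrightarrow> \<bar>of_int D * F / (of_int D * of_int ?b)\<bar>"
    by (intro tendsto_intros) (use b \<open>D \<noteq> 0\<close> in \<open>auto simp del: of_int_mult of_int_diff\<close>)
  moreover have "\<bar>of_int D * F / (of_int D * of_int ?b)\<bar> = \<bar>F / of_int ?b\<bar>"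
    using \<open>D \<noteq> 0\<close> by simp
  ultimately have "\<forall>\<^sub>F k in sequentially. \<bar>V k / (of_int D * of_int ?b)\<bar> < r'"
    using F_less by (intro order_tendstoD(2)) auto
  then obtain k where k: "\<bar>V k / (of_int D * of_int ?b)\<bar> < r'"
    by (auto dest: eventually_happens)
  have L: "of_int (y2 k) - \<xi> * of_int (y1 k) \<noteq> 0"
  proof -
    have "y1 k \<noteq> 0 \<or> y2 k \<noteq> 0"
    proof (rule ccontr)
      assume "\<not> ?thesis"
      then have "D * z1 = 0" "D * z2 = 0"
        unfolding det[of k, symmetric] y1_def y2_def by algebra+
      with z_ne \<open>D \<noteq> 0\<close> show False by simp
    qed
    then show ?thesis
      using irrational_affine_ne_zero[OF irr, of "y2 k" "- y1 k"] by (auto simp: mult.commute)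
  qed

  have "\<exists>Q P. D * (b11 * Q + b12 * P) = x2 l * y1 k - x1 l * y2 k \<and>
              D * (b21 * Q + b22 * P) = x0 l * y2 k - x1 l * y1 k" for l
  proof -
    obtain e0 e1 e2 where e: "x0 k = x0 l + D * ?b * e0" "x1 k = x1 l + D * ?b * e1" "x2 k = x2 l + D * ?b * e2"
      using cong[of k l] by (metis dvdE diff_add_cancel add.commute)
    \<comment> \<open>As \<open>x\<^sub>k = x\<^sub>l + D (det B) e\<close>, one has \<open>adj(x\<^sub>l) x\<^sub>k / D = 1 + (det B) adj(x\<^sub>l) e\<close>, and
        \<open>det B\<close> is \<open>B adj(B)\<close>. Below, \<open>(w1, w2) = adj(x\<^sub>l) e z\<close>.\<close>
    define w1 w2 where "w1 = x2 l * (e0 * z1 + e1 * z2) - x1 l * (e1 * z1 + e2 * z2)"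
      and "w2 = x0 l * (e1 * z1 + e2 * z2) - x1 l * (e0 * z1 + e1 * z2)"
    have "D * (b11 * (int q + b22 * w1 - b12 * w2) + b12 * (p - b21 * w1 + b11 * w2)) = x2 l * y1 k - x1 l * y2 k"
      unfolding y1_def y2_def e z1_def z2_def w1_def w2_def det[of l, symmetric] by algebra
    moreover have "D * (b21 * (int q + b22 * w1 - b12 * w2) + b22 * (p - b21 * w1 + b11 * w2)) = x0 l * y2 k - x1 l * y1 k"
      unfolding y1_def y2_def e z1_def z2_def w1_def w2_def det[of l, symmetric] by algebra
    ultimately show ?thesis by blast
  qed
  then obtain Q P where QP: "\<And>l. D * (b11 * Q l + b12 * P l) = x2 l * y1 k - x1 l * y2 k"
     "\<And>l. D * (b21 * Q l + b22 * P l) = x0 l * y2 k - x1 l * y1 k"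
    by metis
  note lim = moved_approximation_limit[OF \<open>D \<noteq> 0\<close> x0 ratio m1 m2 b \<eta> QP L]
  have lim_less: "\<forall>\<^sub>F l in sequentially. \<bar>of_int (Q l) * (of_int (P l) - \<eta> * of_int (Q l))\<bar> < r'"
    using tendsto_rabs[OF lim(2)] k unfolding V_def by (intro order_tendstoD(2)) auto
  have "\<exists>q p :: int. \<bar>q\<bar> \<ge> K \<and> \<bar>of_int q * (of_int p - \<eta> * of_int q)\<bar> \<le> r'" for K
  proof -
    have "\<forall>\<^sub>F l in sequentially. real_of_int K \<le> \<bar>real_of_int (Q l)\<bar>"
      using lim(1) unfolding filterlim_at_top by blast
    from eventually_happens'[OF sequentially_bot eventually_conj[OF this lim_less]]
    obtain l where l: "real_of_int K \<le> \<bar>real_of_int (Q l)\<bar>"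
      "\<bar>of_int (Q l) * (of_int (P l) - \<eta> * of_int (Q l))\<bar> < r'" by blast
    from l(1) have "K \<le> \<bar>Q l\<bar>" by linarith
    with l(2) show ?thesis by (meson less_imp_le)
  qed
  then have "\<nu> \<eta> \<le> ereal r'"
    by (rule lagrange_const_leI)
  with r' show False by simp
qed

section \<open>Growth of the associated sequence\<close>

lemma superlinear_growth:
  fixes n :: "nat \<Rightarrow> real" and c g :: real
  assumes "c > 0" "g > 1"
    and step: "\<forall>\<^sub>F i in sequentially. c * n i powr g \<le> n (i + 1)"
    and unb: "\<not> bdd_above (n ` {1..})"
  shows "filterlim n at_top sequentially"
    and "filterlim (\<lambda>i. n (i + 2) / n i) at_top sequentially"
proof -
  obtain I where I: "\<And>i. i \<ge> I \<Longrightarrow> c * n i powr g \<le> n (i + 1)"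
    using step by (auto simp: eventually_sequentially)
  \<comment> \<open>Once a term exceeds \<open>R\<close>, the sequence at least doubles at each step.\<close>
  define R where "R = max 1 ((2 / c) powr (1 / (g - 1)))"
  have R1: "R \<ge> 1"
    by (simp add: R_def)
  have R2: "c * R powr (g - 1) \<ge> 2"
  proof -
    have "2 / c = ((2 / c) powr (1 / (g - 1))) powr (g - 1)"
      using assms(1,2) by (simp add: powr_powr)
    also have "\<dots> \<le> R powr (g - 1)"
      using assms(1,2) by (intro powr_mono2) (auto simp: R_def)
    finally show ?thesis
      using \<open>c > 0\<close> by (simp add: field_simps)
  qed
  obtain j where j: "j \<ge> I" "n j \<ge> R"
  proof (rule ccontr)
    assume "\<not> thesis"
    then have "n i \<le> R" if "i \<ge> I" for i
      using that \<open>\<And>j. \<lbrakk>j \<ge> I; n j \<ge> R\<rbrakk> \<Longrightarrow> thesis\<close> by (meson linear)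
    then have "n ` {1..} \<subseteq> n ` {..I} \<union> {..R}"
      by (metis UnI1 UnI2 atMost_iff image_eqI image_subsetI linear)
    moreover have "bdd_above (n ` {..I} \<union> {..R})"
      by simp
    ultimately have "bdd_above (n ` {1..})"
      by (rule bdd_above_mono[rotated])
    with unb show False ..
  qed
  have lower: "n (j + k) \<ge> R * 2 ^ k" for k
  proof (induction k)
    case (Suc k)
    have "R * 1 \<le> R * 2 ^ k"
      using R1 by (intro mult_left_mono) auto
    with Suc have nR: "n (j + k) \<ge> R" by linarith
    have "2 * n (j + k) \<le> (c * R powr (g - 1)) * n (j + k)"
      using R1 R2 nR by (intro mult_right_mono) auto
    also have "\<dots> \<le> (c * n (j + k) powr (g - 1)) * n (j + k)"
      using R1 nR assms(1,2) by (intro mult_right_mono mult_left_mono powr_mono2) auto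
    also have "\<dots> = c * n (j + k) powr g"
      using R1 nR by (simp add: powr_diff)
    also have "\<dots> \<le> n (j + Suc k)"
      using I[of "j + k"] j(1) by simp
    finally show ?case
      using Suc by simp
  qed (use j in simp)
  have "filterlim (\<lambda>k. n (j + k)) at_top sequentially"
  proof (rule filterlim_at_top_mono[OF filterlim_real_sequentially], intro always_eventually allI)
    fix k
    have "real k \<le> 2 ^ k"
      using of_nat_less_two_power[of k, where 'a = real] by simp
    also have "\<dots> \<le> R * 2 ^ k"
      using R1 by simp
    finally show "real k \<le> n (j + k)"
      using lower[of k] by simp
  qed
  then have "filterlim (\<lambda>k. n (k + j)) at_top sequentially"
    by (simp add: add.commute)
  then show top: "filterlim n at_top sequentially"
    unfolding filterlim_at_top using eventually_sequentially_seg[where k = j] by blast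
  have ratio: "filterlim (\<lambda>i. n (i + 1) / n i) at_top sequentially"
  proof (rule filterlim_at_top_mono)
    have "filterlim (\<lambda>x::real. x powr (g - 1)) at_top at_top"
    proof (rule filterlim_mono_eventually[OF _ order_refl order_refl])
      show "filterlim (\<lambda>x::real. exp ((g - 1) * ln x)) at_top at_top"
        using assms(2) by (intro filterlim_compose[OF exp_at_top]
          filterlim_tendsto_pos_mult_at_top[OF tendsto_const] ln_at_top) simp
      show "\<forall>\<^sub>F x::real in at_top. exp ((g - 1) * ln x) = x powr (g - 1)"
        using eventually_gt_at_top[of 0] by eventually_elim (simp add: powr_def)
    qed
    then have "filterlim (\<lambda>i. n i powr (g - 1)) at_top sequentially"
      by (rule filterlim_compose[OF _ top])
    then show "filterlim (\<lambda>i. c * n i powr (g - 1)) at_top sequentially"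
      by (intro filterlim_tendsto_pos_mult_at_top[OF tendsto_const] assms(1))
    show "\<forall>\<^sub>F i in sequentially. c * n i powr (g - 1) \<le> n (i + 1) / n i"
      using step filterlim_at_top_dense[THEN iffD1, OF top, rule_format, of 0]
      by eventually_elim (simp add: powr_diff field_simps)
  qed
  have "filterlim (\<lambda>i. (n (i + 2) / n (i + 1)) * (n (i + 1) / n i)) at_top sequentially"
    using filterlim_compose[OF ratio filterlim_Suc] ratio
    by (intro filterlim_at_top_mult_at_top) simp_all
  moreover have "\<forall>\<^sub>F i in sequentially. (n (i + 2) / n (i + 1)) * (n (i + 1) / n i) = n (i + 2) / n i"
    using filterlim_at_top_dense[THEN iffD1, OF filterlim_compose[OF top filterlim_Suc], rule_format, of 0]
    by eventually_elim simp
  ultimately show "filterlim (\<lambda>i. n (i + 2) / n i) at_top sequentially"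
    by (rule filterlim_mono_eventually[OF _ order_refl order_refl])
qed

text \<open>The consequences of the defining properties of \<open>x\<close> that are needed, with \<open>n i\<close> the norm
  of \<open>x i\<close>. The upper left entry is comparable to the norm because the smallness of
  \<open>(\<xi>, -1) x i\<close> makes the other entries close to \<open>\<xi>\<close> and \<open>\<xi>\<^sup>2\<close> times that entry.\<close>

lemma assoc_sequence_facts:
  assumes "assoc_sequence \<xi> x"
  obtains n c C where "c > 0" "C > 0"
    "filterlim n at_top sequentially"
    "filterlim (\<lambda>i. n (i + 2) / n i) at_top sequentially"
    "\<forall>\<^sub>F i in sequentially. x i $ 2 $ 1 = x i $ 1 $ 2 \<and> det (x i) \<noteq> 0 \<and> real_of_int \<bar>det (x i)\<bar> \<le> C"
    "\<forall>\<^sub>F i in sequentially. c * n i \<le> \<bar>real_of_int (x i $ 1 $ 1)\<bar> \<and> \<bar>real_of_int (x i $ 1 $ 1)\<bar> \<le> n i"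
    "\<forall>\<^sub>F i in sequentially. \<bar>\<xi> * of_int (x i $ 1 $ 1) - of_int (x i $ 1 $ 2)\<bar> \<le> C / n i"
proof -
  define n where "n i = infnorm (real_mat (x i))" for i
  define v where "v i = vector [\<xi>, -1] v* real_mat (x i)" for i
  have in_P: "\<forall>i\<ge>1. x i \<in> \<P> \<and> transpose (x i) = x i"
    and unb: "\<not> bdd_above (n ` {1..})"
    and \<Theta>_step: "(\<lambda>i. n (i + 1)) \<in> \<Theta>(\<lambda>i. n i powr \<gamma>\<^sub>g)"
    and \<Theta>_v: "(\<lambda>i. infnorm (v i)) \<in> \<Theta>(\<lambda>i. inverse (n i))"
    and \<Theta>_det: "(\<lambda>i. real_of_int \<bar>det (x i)\<bar>) \<in> \<Theta>(\<lambda>_. 1)"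
    using assms unfolding assoc_sequence_def n_def v_def by auto
  have n0: "n i \<ge> 0" for i
    by (simp add: n_def infnorm_pos_le)
  obtain c0 where c0: "c0 > 0" "\<forall>\<^sub>F i in sequentially. c0 * n i powr \<gamma>\<^sub>g \<le> n (i + 1)"
    using bigthetaD2[OF \<Theta>_step] by (elim landau_omega.bigE) (simp add: n0)
  have "\<gamma>\<^sub>g > 1"
    by (simp add: golden_def)
  note growth = superlinear_growth[OF c0(1) this c0(2)]
  have top: "filterlim n at_top sequentially"
    and ratio: "filterlim (\<lambda>i. n (i + 2) / n i) at_top sequentially"
    using growth[OF unb] by simp_all
  obtain C1 where C1: "C1 > 0" "\<forall>\<^sub>F i in sequentially. infnorm (v i) \<le> C1 / n i"
    using bigthetaD1[OF \<Theta>_v] by (elim landau_o.bigE) (simp add: n0 infnorm_pos_le divide_inverse)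
  obtain C2 where C2: "C2 > 0" "\<forall>\<^sub>F i in sequentially. real_of_int \<bar>det (x i)\<bar> \<le> C2"
    using bigthetaD1[OF \<Theta>_det] by (elim landau_o.bigE) simp
  have det: "\<forall>\<^sub>F i in sequentially. x i $ 2 $ 1 = x i $ 1 $ 2 \<and> det (x i) \<noteq> 0"
    using eventually_ge_at_top[of 1]
  proof eventually_elim
    case (elim i)
    then have "transpose (x i) = x i" "x i \<in> \<P>"
      using in_P by auto
    then have "transpose (x i) $ 1 $ 2 = x i $ 1 $ 2" "det (x i) \<noteq> 0"
      by (simp_all add: primitive_mats_def)
    then show ?case
      by (simp add: transpose_def)
  qed
  have entries: "{\<bar>real_mat (x i) $ r $ s\<bar> | r s. True} = (\<lambda>(r, s). \<bar>real_of_int (x i $ r $ s)\<bar>) ` UNIV" for i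
    by (auto simp: map_matrix_def)
  have entry: "\<bar>real_of_int (x i $ r $ s)\<bar> \<le> n i" for i r s
    unfolding n_def infnorm_matrix_eq entries by (rule Max_ge) auto
  have entry_max: "\<exists>r s. n i = \<bar>real_of_int (x i $ r $ s)\<bar>" for i
  proof -
    have "n i \<in> (\<lambda>(r, s). \<bar>real_of_int (x i $ r $ s)\<bar>) ` UNIV"
      unfolding n_def infnorm_matrix_eq entries by (rule Max_in) auto
    then show ?thesis
      by auto
  qed
  have v_bound: "\<forall>\<^sub>F i in sequentially. \<bar>\<xi> * of_int (x i $ 1 $ r) - of_int (x i $ 2 $ r)\<bar> \<le> C1 / n i" for r
    using C1(2)
  proof eventually_elim
    case (elim i)
    have "v i $ r = \<xi> * of_int (x i $ 1 $ r) - of_int (x i $ 2 $ r)"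
      by (simp add: v_def vector_matrix_mult_def sum_2 map_matrix_def)
    then show ?case
      using component_le_infnorm_cart[of "v i" r] elim by simp
  qed
  define c where "c = 1 / (2 * (1 + \<bar>\<xi>\<bar> + \<xi>\<^sup>2))"
  have den: "1 + \<bar>\<xi>\<bar> + \<xi>\<^sup>2 > 0"
    by (smt (verit) zero_le_power2)
  have "\<forall>\<^sub>F i in sequentially. c * n i \<le> \<bar>real_of_int (x i $ 1 $ 1)\<bar>"
    using v_bound[of 1] v_bound[of 2] det filterlim_at_top[THEN iffD1, OF top, rule_format, of "max C1 (2 * (2 + \<bar>\<xi>\<bar>))"]
  proof eventually_elim
    case (elim i)
    let ?a = "\<bar>real_of_int (x i $ 1 $ 1)\<bar>"
    have C1n: "C1 / n i \<le> 1"
      using elim(4) C1(1) by (auto simp: field_simps)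
    have a1: "\<bar>real_of_int (x i $ 1 $ 2)\<bar> \<le> \<bar>\<xi>\<bar> * ?a + 1"
      using elim(1,3) C1n abs_mult[of \<xi> "of_int (x i $ 1 $ 1)"] by simp
    have "\<bar>real_of_int (x i $ 2 $ 2)\<bar> \<le> \<bar>\<xi>\<bar> * \<bar>real_of_int (x i $ 1 $ 2)\<bar> + 1"
      using elim(2) C1n abs_mult[of \<xi> "of_int (x i $ 1 $ 2)"] by simp
    also have "\<dots> \<le> \<bar>\<xi>\<bar> * (\<bar>\<xi>\<bar> * ?a + 1) + 1"
      using a1 by (intro add_right_mono mult_left_mono) auto
    finally have a2: "\<bar>real_of_int (x i $ 2 $ 2)\<bar> \<le> \<xi>\<^sup>2 * ?a + \<bar>\<xi>\<bar> + 1"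
      by (simp add: power2_eq_square algebra_simps)
    have "n i \<le> ?a + (\<bar>\<xi>\<bar> * ?a + 1) + (\<xi>\<^sup>2 * ?a + \<bar>\<xi>\<bar> + 1)"
    proof -
      obtain r s where "n i = \<bar>real_of_int (x i $ r $ s)\<bar>"
        using entry_max by blast
      then have "n i = ?a \<or> n i = \<bar>real_of_int (x i $ 1 $ 2)\<bar> \<or> n i = \<bar>real_of_int (x i $ 2 $ 2)\<bar>"
        using exhaust_2[of r] exhaust_2[of s] elim(3) by auto
      moreover have "0 \<le> \<bar>\<xi>\<bar> * ?a" "0 \<le> \<xi>\<^sup>2 * ?a"
        by (rule mult_nonneg_nonneg, simp_all)+
      ultimately show ?thesis
        using a1 a2 by linarith
    qed
    also have "\<dots> = (1 + \<bar>\<xi>\<bar> + \<xi>\<^sup>2) * ?a + (2 + \<bar>\<xi>\<bar>)"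
      by (simp add: algebra_simps)
    also have "\<dots> \<le> (1 + \<bar>\<xi>\<bar> + \<xi>\<^sup>2) * ?a + n i / 2"
      using elim(4) by simp
    finally show ?case
      unfolding c_def using den by (simp add: field_simps)
  qed
  then have a: "\<forall>\<^sub>F i in sequentially. c * n i \<le> \<bar>real_of_int (x i $ 1 $ 1)\<bar> \<and> \<bar>real_of_int (x i $ 1 $ 1)\<bar> \<le> n i"
    using entry by simp
  have n_pos: "\<forall>\<^sub>F i in sequentially. n i > 0"
    using top by (simp add: filterlim_at_top_dense)
  show thesis
  proof (rule that[of c "max C1 C2" n])
    show "\<forall>\<^sub>F i in sequentially. x i $ 2 $ 1 = x i $ 1 $ 2 \<and> det (x i) \<noteq> 0 \<and> real_of_int \<bar>det (x i)\<bar> \<le> max C1 C2"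
      using det C2(2) by eventually_elim auto
    show "\<forall>\<^sub>F i in sequentially. \<bar>\<xi> * of_int (x i $ 1 $ 1) - of_int (x i $ 1 $ 2)\<bar> \<le> max C1 C2 / n i"
      using v_bound[of 1] det n_pos
    proof eventually_elim
      case (elim i)
      have "C1 / n i \<le> max C1 C2 / n i"
        using elim by (intro divide_right_mono) auto
      with elim show ?case by simp
    qed
  qed (use top ratio a C1 den in \<open>auto simp: c_def\<close>)
qed

section \<open>Directions of the adjugates along the recurrence\<close>

lemma star_mult_entry:
  "coeffs_gcd (A ** B) * (A \<star> B) $ i $ j = (A ** B) $ i $ j"
proof -
  have "coeffs_gcd (A ** B) dvd (A ** B) $ i $ j"
    unfolding coeffs_gcd_def by (rule Gcd_dvd) blast
  then show ?thesis
    by (simp add: star_mult_def map_matrix_def)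
qed

text \<open>Only the ratios of the entries of \<^term>\<open>x (i + 2)\<close> matter, so the common divisors
  that \<^term>\<open>A \<star> B\<close> removes, and the sign, are collected in one unspecified factor.\<close>

lemma star_triple_multiple:
  assumes "X = A \<star> M \<star> B \<or> X = - (A \<star> M \<star> B)"
  obtains l where "\<And>i j. l * X $ i $ j = (A ** M ** B) $ i $ j"
proof -
  define g h where "g = coeffs_gcd (A ** M)" and "h = coeffs_gcd ((A \<star> M) ** B)"
  have *: "g * h * (A \<star> M \<star> B) $ i $ j = (A ** M ** B) $ i $ j" for i j
  proof -
    have "g * h * (A \<star> M \<star> B) $ i $ j = g * ((A \<star> M) ** B) $ i $ j"
      by (simp add: h_def star_mult_entry mult.assoc)
    also have "\<dots> = (\<Sum>k\<in>UNIV. (g * (A \<star> M) $ i $ k) * B $ k $ j)"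
      by (simp add: matrix_matrix_mult_def sum_distrib_left mult.assoc)
    also have "\<dots> = (A ** M ** B) $ i $ j"
      unfolding g_def star_mult_entry by (simp add: matrix_matrix_mult_def)
    finally show ?thesis .
  qed
  show ?thesis
    using assms that[of "g * h"] that[of "- (g * h)"] * by auto
qed

text \<open>
  Let \<open>x\<close>, \<open>y\<close>, \<open>X\<close> be consecutive symmetric matrices with \<open>X\<close> proportional to \<open>y G x\<close>. The first row
  of \<open>X\<close> is then proportional to the first row of \<open>y G\<close> times \<open>x\<close>; its direction approximates
  that of \<open>u = (1, \<xi>)\<close> far better than the first row of \<open>x\<close> does (hypothesis \<open>err\<close>), while
  the first row of \<open>y\<close> has direction close to \<open>u\<close>. Hence
  \<open>adj(x) u\<close> is close to the direction of \<open>G\<^sup>t u\<close>, and the scaling follows from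
  \<open>u \<bullet> adj(x) u \<approx> D / x0\<close>.
\<close>

lemma adjugate_limit:
  fixes \<xi> g11 g12 g21 g22 w :: real and x0 x1 x2 y0 y1 X0 X1 l :: "nat \<Rightarrow> int" and D :: int
  defines "w \<equiv> (g11 + \<xi> * g21) + \<xi> * (g12 + \<xi> * g22)"
  assumes det: "\<And>k. x0 k * x2 k - x1 k * x1 k = D"
    and x0: "filterlim (\<lambda>k. \<bar>real_of_int (x0 k)\<bar>) at_top sequentially"
    and ratio: "(\<lambda>k. of_int (x1 k) / of_int (x0 k)) \<longlonglongrightarrow> \<xi>"
    and ratio': "(\<lambda>k. of_int (y1 k) / of_int (y0 k)) \<longlonglongrightarrow> \<xi>"
    and ne: "\<And>k. y0 k \<noteq> 0" "\<And>k. X0 k \<noteq> 0"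
    and err: "(\<lambda>k. (of_int (x0 k))\<^sup>2 * (\<xi> - of_int (X1 k) / of_int (X0 k))) \<longlonglongrightarrow> 0"
    and rec0: "\<And>k. of_int (l k * X0 k) = (of_int (y0 k) * g11 + of_int (y1 k) * g21) * of_int (x0 k)
                      + (of_int (y0 k) * g12 + of_int (y1 k) * g22) * of_int (x1 k)"
    and rec1: "\<And>k. of_int (l k * X1 k) = (of_int (y0 k) * g11 + of_int (y1 k) * g21) * of_int (x1 k)
                      + (of_int (y0 k) * g12 + of_int (y1 k) * g22) * of_int (x2 k)"
    and w: "w \<noteq> 0"
  shows "(\<lambda>k. of_int (x0 k) * (\<xi> * of_int (x0 k) - of_int (x1 k))) \<longlonglongrightarrow> of_int D * ((g12 + \<xi> * g22) / w)"
    and "(\<lambda>k. of_int (x0 k) * (of_int (x2 k) - \<xi> * of_int (x1 k))) \<longlonglongrightarrow> of_int D * ((g11 + \<xi> * g21) / w)"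
proof -
  define r where "r k = real_of_int (y1 k) / of_int (y0 k)" for k
  define R where "R k = real_of_int (x1 k) / of_int (x0 k)" for k
  define h1 h2 where "h1 k = g11 + r k * g21" and "h2 k = g12 + r k * g22" for k
  define S where "S k = h1 k + R k * h2 k" for k
  have r: "r \<longlonglongrightarrow> \<xi>" and R: "R \<longlonglongrightarrow> \<xi>"
    using ratio ratio' by (simp_all add: r_def[abs_def] R_def[abs_def])
  have S: "S \<longlonglongrightarrow> w"
    unfolding S_def[abs_def] w_def h1_def h2_def by (intro tendsto_intros r R)
  have x0_ne: "\<forall>\<^sub>F k in sequentially. x0 k \<noteq> 0"
    using x0[unfolded filterlim_at_top, rule_format, of 1] by eventually_elim auto
  have "(\<lambda>k. (of_int (x0 k))\<^sup>2 * (\<xi> - of_int (X1 k) / of_int (X0 k)) + of_int D * h2 k / S k)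
          \<longlonglongrightarrow> 0 + of_int D * (g12 + \<xi> * g22) / w"
    unfolding h2_def by (intro tendsto_intros err r S w)
  moreover have "\<forall>\<^sub>F k in sequentially. (of_int (x0 k))\<^sup>2 * (\<xi> - of_int (X1 k) / of_int (X0 k)) + of_int D * h2 k / S k
     = of_int (x0 k) * (\<xi> * of_int (x0 k) - of_int (x1 k))"
    using x0_ne tendsto_imp_eventually_ne[OF S w]
  proof eventually_elim
    case (elim k)
    define a0 a1 a2 where "a0 = real_of_int (x0 k)" and "a1 = real_of_int (x1 k)" and "a2 = real_of_int (x2 k)"
    have a0: "a0 \<noteq> 0" and y0: "real_of_int (y0 k) \<noteq> 0"
      using elim ne by (simp_all add: a0_def)
    have D: "of_int D = a0 * a2 - a1 * a1"
      unfolding det[of k, symmetric] by (simp add: a0_def a1_def a2_def)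
    have Sk: "a0 * S k = a0 * h1 k + a1 * h2 k"
      using a0 by (simp add: S_def R_def a0_def a1_def distrib_left)
    have y1: "of_int (y1 k) = of_int (y0 k) * r k"
      using y0 by (simp add: r_def)
    have "of_int (l k) * of_int (X0 k) = of_int (y0 k) * (a0 * h1 k + a1 * h2 k)"
      using rec0[of k] unfolding y1 by (simp add: a0_def a1_def h1_def h2_def algebra_simps)
    then have l0: "of_int (l k) * of_int (X0 k) = of_int (y0 k) * (a0 * S k)"
      unfolding Sk .
    have l1: "of_int (l k) * of_int (X1 k) = of_int (y0 k) * (a1 * h1 k + a2 * h2 k)"
      using rec1[of k] unfolding y1 by (simp add: a1_def a2_def h1_def h2_def algebra_simps)
    have "real_of_int (l k) \<noteq> 0"
      using l0 y0 a0 elim by auto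
    then have "real_of_int (X1 k) / of_int (X0 k) = (of_int (l k) * of_int (X1 k)) / (of_int (l k) * of_int (X0 k))"
      by simp
    also have "\<dots> = (a1 * h1 k + a2 * h2 k) / (a0 * S k)"
      unfolding l0 l1 using y0 by simp
    finally have X: "real_of_int (X1 k) / of_int (X0 k) = (a1 * h1 k + a2 * h2 k) / (a0 * S k)" .
    have "a0 * (a1 * h1 k + a2 * h2 k) = a1 * (a0 * S k) + of_int D * h2 k"
      unfolding D Sk by (simp add: algebra_simps)
    then have "a0\<^sup>2 * ((a1 * h1 k + a2 * h2 k) / (a0 * S k)) = a0 * a1 + of_int D * h2 k / S k"
      using a0 elim(2) by (simp add: field_simps power2_eq_square)
    then show ?case
      unfolding X a0_def[symmetric] a1_def[symmetric] by (simp add: algebra_simps power2_eq_square)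
  qed
  ultimately have "(\<lambda>k. of_int (x0 k) * (\<xi> * of_int (x0 k) - of_int (x1 k))) \<longlonglongrightarrow> 0 + of_int D * (g12 + \<xi> * g22) / w"
    by (rule Lim_transform_eventually)
  then show lim: "(\<lambda>k. of_int (x0 k) * (\<xi> * of_int (x0 k) - of_int (x1 k))) \<longlonglongrightarrow> of_int D * ((g12 + \<xi> * g22) / w)"
    by simp
  let ?L = "\<lambda>k. of_int (x0 k) * (\<xi> * of_int (x0 k) - of_int (x1 k))"
  have inv: "(\<lambda>k. inverse (of_int (x0 k)) :: real) \<longlonglongrightarrow> 0"
    using x0 by (intro tendsto_inverse_0[THEN filterlim_compose]) (simp add: filterlim_at_infinity_conv_norm_at_top)
  \<comment> \<open>The second limit follows from \<open>x0 (x2 - \<xi> x1) = D + (\<xi> x0 - x1)\<^sup>2 - \<xi> x0 (\<xi> x0 - x1)\<close>.\<close>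
  have "(\<lambda>k. of_int D + (?L k * inverse (of_int (x0 k)))\<^sup>2 - \<xi> * ?L k)
     \<longlonglongrightarrow> of_int D + (of_int D * ((g12 + \<xi> * g22) / w) * 0)\<^sup>2 - \<xi> * (of_int D * ((g12 + \<xi> * g22) / w))"
    by (intro tendsto_intros lim inv)
  also have "of_int D + (of_int D * ((g12 + \<xi> * g22) / w) * 0)\<^sup>2 - \<xi> * (of_int D * ((g12 + \<xi> * g22) / w))
      = of_int D * ((w - \<xi> * (g12 + \<xi> * g22)) / w)"
    using w by (simp add: field_simps)
  also have "w - \<xi> * (g12 + \<xi> * g22) = g11 + \<xi> * g21"
    by (simp add: w_def)
  finally show "(\<lambda>k. of_int (x0 k) * (of_int (x2 k) - \<xi> * of_int (x1 k))) \<longlonglongrightarrow> of_int D * ((g11 + \<xi> * g21) / w)"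
  proof (rule Lim_transform_eventually)
    show "\<forall>\<^sub>F k in sequentially. of_int D + (?L k * inverse (of_int (x0 k)))\<^sup>2 - \<xi> * ?L k
      = of_int (x0 k) * (of_int (x2 k) - \<xi> * of_int (x1 k))"
      using x0_ne
    proof eventually_elim
      case (elim k)
      have D: "real_of_int D = of_int (x0 k) * of_int (x2 k) - of_int (x1 k) * of_int (x1 k)"
        unfolding det[of k, symmetric] by simp
      have "?L k * inverse (of_int (x0 k)) = \<xi> * of_int (x0 k) - of_int (x1 k)"
        using elim by simp
      then show ?case
        unfolding D by (simp only: power2_eq_square) (simp add: algebra_simps)
    qed
  qed
qed

text \<open>Matrices of bounded non-zero determinant: the determinant and, modulo a multiple of it, the
  entries take finitely many values, so that one combination of values recurs.\<close>

lemma congruent_subsequence: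
  fixes x :: "nat \<Rightarrow> imat" and N :: int
  assumes "infinite I" "N \<noteq> 0"
    and bound: "\<And>i. i \<in> I \<Longrightarrow> det (x i) \<noteq> 0 \<and> real_of_int \<bar>det (x i)\<bar> \<le> C"
  obtains s :: "nat \<Rightarrow> nat" and D where "strict_mono s" "range s \<subseteq> I" "D \<noteq> 0" "\<And>k. det (x (s k)) = D"
    "\<And>k k' i j. D * N dvd x (s k) $ i $ j - x (s k') $ i $ j"
proof -
  define key where "key i = (det (x i), (\<lambda>(r, s). x i $ r $ s mod (det (x i) * N)))" for i
  define K where "K = \<lfloor>C\<rfloor>"
  have "key ` I \<subseteq> {-K..K} \<times> (UNIV \<rightarrow>\<^sub>E {- (K * \<bar>N\<bar>)..K * \<bar>N\<bar>})"
  proof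
    fix z assume "z \<in> key ` I"
    then obtain i where i: "i \<in> I" "z = key i" by blast
    have K: "\<bar>det (x i)\<bar> \<le> K"
      using bound[OF i(1)] by (simp add: K_def le_floor_iff)
    have "\<bar>x i $ r $ s mod (det (x i) * N)\<bar> \<le> K * \<bar>N\<bar>" for r s
    proof -
      have "\<bar>x i $ r $ s mod (det (x i) * N)\<bar> < \<bar>det (x i) * N\<bar>"
        using bound[OF i(1)] \<open>N \<noteq> 0\<close> by (intro abs_mod_less) auto
      also have "\<dots> \<le> K * \<bar>N\<bar>"
        using K by (simp add: abs_mult mult_right_mono)
      finally show ?thesis by simp
    qed
    then show "z \<in> {-K..K} \<times> (UNIV \<rightarrow>\<^sub>E {- (K * \<bar>N\<bar>)..K * \<bar>N\<bar>})"
      using K by (auto simp: i key_def abs_le_iff minus_le_iff)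
  qed
  moreover have "finite ({-K..K} \<times> ((UNIV :: (2 \<times> 2) set) \<rightarrow>\<^sub>E {- (K * \<bar>N\<bar>)..K * \<bar>N\<bar>}))"
    by (intro finite_cartesian_product finite_PiE) auto
  ultimately have "finite (key ` I)"
    by (rule finite_subset)
  then obtain i0 where i0: "i0 \<in> I" "infinite {i \<in> I. key i = key i0}"
    using pigeonhole_infinite[OF \<open>infinite I\<close>] by blast
  obtain s :: "nat \<Rightarrow> nat" where s: "strict_mono s" "\<forall>k. s k \<in> {i \<in> I. key i = key i0}"
    using infinite_enumerate[OF i0(2)] by blast
  have s_I: "s k \<in> I" and s_key: "key (s k) = key i0" for k
    using s(2) by auto
  show thesis
  proof (rule that[of s "det (x i0)"])
    show D: "det (x (s k)) = det (x i0)" for k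
      using s_key[of k] by (simp add: key_def)
    show "det (x i0) * N dvd x (s k) $ i $ j - x (s k') $ i $ j" for k k' i j
    proof -
      have "x (s k) $ i $ j mod (det (x i0) * N) = x (s k') $ i $ j mod (det (x i0) * N)"
        using s_key[of k] s_key[of k'] by (auto simp: key_def dest!: fun_cong[where x = "(i, j)"])
      then show ?thesis
        by (simp add: mod_eq_dvd_iff)
    qed
  qed (use s(1) s_I i0 bound in auto)
qed

text \<open>Here \<open>(h1, h2) = G\<^sup>t (1, \<xi>)\<close>. The hypotheses on \<open>\<eta>\<close> and \<open>\<eta>'\<close> say that \<open>B (1, \<eta>)\<close> and
  \<open>B (1, \<eta>')\<close> are parallel to \<open>(-\<xi>, 1)\<close> and to \<open>(h1, h2)\<close>.\<close>

lemma lagrange_const_le_of_recurrence: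
  fixes \<xi> \<eta> \<eta>' :: real and x :: "nat \<Rightarrow> imat" and G :: imat and b11 b12 b21 b22 :: int
  defines "h1 \<equiv> of_int (G $ 1 $ 1) + \<xi> * of_int (G $ 2 $ 1)"
    and "h2 \<equiv> of_int (G $ 1 $ 2) + \<xi> * of_int (G $ 2 $ 2)"
  assumes irr: "\<xi> \<notin> \<rat>"
    and seq: "assoc_sequence \<xi> x"
    and I: "infinite I"
    and rec: "\<And>i. i \<in> I \<Longrightarrow> \<exists>l. \<forall>r s. l * x (i + 2) $ r $ s = (x (i + 1) ** G ** x i) $ r $ s"
    and w: "h1 + \<xi> * h2 \<noteq> 0"
    and b: "b11 * b22 - b12 * b21 \<noteq> 0"
    and \<eta>: "of_int b11 + of_int b12 * \<eta> = - \<xi> * (of_int b21 + of_int b22 * \<eta>)"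
    and \<eta>': "(of_int b11 + of_int b12 * \<eta>') * h2 = (of_int b21 + of_int b22 * \<eta>') * h1"
  shows "\<nu> \<eta> \<le> \<nu> \<eta>'"
proof -
  obtain n c C where cC: "c > 0" "C > 0"
    and top: "filterlim n at_top sequentially"
    and growth: "filterlim (\<lambda>i. n (i + 2) / n i) at_top sequentially"
    and det_ev: "\<forall>\<^sub>F i in sequentially. x i $ 2 $ 1 = x i $ 1 $ 2 \<and> det (x i) \<noteq> 0 \<and> real_of_int \<bar>det (x i)\<bar> \<le> C"
    and x0_ev: "\<forall>\<^sub>F i in sequentially. c * n i \<le> \<bar>real_of_int (x i $ 1 $ 1)\<bar> \<and> \<bar>real_of_int (x i $ 1 $ 1)\<bar> \<le> n i"
    and err_ev: "\<forall>\<^sub>F i in sequentially. \<bar>\<xi> * of_int (x i $ 1 $ 1) - of_int (x i $ 1 $ 2)\<bar> \<le> C / n i"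
    by (rule assoc_sequence_facts[OF seq])
  have n_pos: "\<forall>\<^sub>F i in sequentially. n i > 0"
    using top by (simp add: filterlim_at_top_dense)
  define R where "R i = real_of_int (x i $ 1 $ 2) / of_int (x i $ 1 $ 1)" for i
  have R_bound: "\<forall>\<^sub>F i in sequentially. \<bar>\<xi> - R i\<bar> \<le> C / c * (inverse (n i))\<^sup>2"
    using x0_ev err_ev n_pos
  proof eventually_elim
    case (elim i)
    let ?a = "\<bar>real_of_int (x i $ 1 $ 1)\<bar>"
    have a: "c * n i > 0" "c * n i \<le> ?a"
      using elim cC by auto
    have "\<bar>\<xi> - R i\<bar> * ?a = \<bar>\<xi> * of_int (x i $ 1 $ 1) - of_int (x i $ 1 $ 2)\<bar>"
      using a by (auto simp: R_def abs_mult[symmetric] left_diff_distrib)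
    then have "\<bar>\<xi> - R i\<bar> * ?a \<le> C / n i"
      using elim by simp
    moreover have "\<bar>\<xi> - R i\<bar> * (c * n i) \<le> \<bar>\<xi> - R i\<bar> * ?a"
      using a by (intro mult_left_mono) auto
    ultimately have "\<bar>\<xi> - R i\<bar> * (c * n i) \<le> C / n i"
      by linarith
    then show ?case
      using elim cC by (simp add: field_simps power2_eq_square)
  qed
  have R: "R \<longlonglongrightarrow> \<xi>"
  proof -
    have "(\<lambda>i. C / c * (inverse (n i))\<^sup>2) \<longlonglongrightarrow> C / c * 0\<^sup>2"
      by (intro tendsto_intros tendsto_inverse_0_at_top top)
    then have "(\<lambda>i. \<xi> - R i) \<longlonglongrightarrow> 0"
      by (intro Lim_null_comparison[OF R_bound[folded real_norm_def]]) simp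
    then show ?thesis
      using tendsto_diff[OF tendsto_const[of \<xi>], of "\<lambda>i. \<xi> - R i"] by fastforce
  qed
  have err: "(\<lambda>i. (of_int (x i $ 1 $ 1))\<^sup>2 * (\<xi> - R (i + 2))) \<longlonglongrightarrow> 0"
  proof (rule Lim_null_comparison)
    have R_bound2: "\<forall>\<^sub>F i in sequentially. \<bar>\<xi> - R (i + 2)\<bar> \<le> C / c * (inverse (n (i + 2)))\<^sup>2"
      using R_bound by (subst eventually_sequentially_seg[where k = 2]) 
    show "\<forall>\<^sub>F i in sequentially. norm ((of_int (x i $ 1 $ 1))\<^sup>2 * (\<xi> - R (i + 2)))
            \<le> C / c * (inverse (n (i + 2) / n i))\<^sup>2"
      using R_bound2 x0_ev n_pos
    proof eventually_elim
      case (elim i)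
      have "(real_of_int (x i $ 1 $ 1))\<^sup>2 \<le> (n i)\<^sup>2"
        using elim by (simp add: abs_le_square_iff[symmetric])
      then have "(real_of_int (x i $ 1 $ 1))\<^sup>2 * \<bar>\<xi> - R (i + 2)\<bar> \<le> (n i)\<^sup>2 * (C / c * (inverse (n (i + 2)))\<^sup>2)"
        using elim by (intro mult_mono) auto
      moreover have "(n i)\<^sup>2 * (C / c * (inverse (n (i + 2)))\<^sup>2) = C / c * (inverse (n (i + 2) / n i))\<^sup>2"
        by (simp add: power_divide power_inverse field_simps)
      ultimately show ?case
        by (simp only: real_norm_def abs_mult abs_power2)
    qed
    have "(\<lambda>i. C / c * (inverse (n (i + 2) / n i))\<^sup>2) \<longlonglongrightarrow> C / c * 0\<^sup>2"
      by (intro tendsto_intros tendsto_inverse_0_at_top growth)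
    then show "(\<lambda>i. C / c * (inverse (n (i + 2) / n i))\<^sup>2) \<longlonglongrightarrow> 0"
      by simp
  qed
  have x0: "filterlim (\<lambda>i. \<bar>real_of_int (x i $ 1 $ 1)\<bar>) at_top sequentially"
  proof (rule filterlim_at_top_mono)
    show "filterlim (\<lambda>i. c * n i) at_top sequentially"
      by (intro filterlim_tendsto_pos_mult_at_top[OF tendsto_const] cC top)
    show "\<forall>\<^sub>F i in sequentially. c * n i \<le> \<bar>real_of_int (x i $ 1 $ 1)\<bar>"
      using x0_ev by eventually_elim simp
  qed
  have "\<forall>\<^sub>F i in sequentially. x i $ 1 $ 1 \<noteq> 0"
    using x0[unfolded filterlim_at_top, rule_format, of 1] by eventually_elim auto
  with det_ev have "\<forall>\<^sub>F i in sequentially. x i $ 1 $ 1 \<noteq> 0 \<and>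
      x i $ 2 $ 1 = x i $ 1 $ 2 \<and> det (x i) \<noteq> 0 \<and> real_of_int \<bar>det (x i)\<bar> \<le> C"
    by eventually_elim simp
  then obtain i0 where i0: "\<And>i. i \<ge> i0 \<Longrightarrow> x i $ 1 $ 1 \<noteq> 0 \<and>
      x i $ 2 $ 1 = x i $ 1 $ 2 \<and> det (x i) \<noteq> 0 \<and> real_of_int \<bar>det (x i)\<bar> \<le> C"
    by (auto simp: eventually_sequentially)
  have "infinite {i \<in> I. i \<ge> i0}"
  proof
    assume "finite {i \<in> I. i \<ge> i0}"
    then have "finite ({i \<in> I. i \<ge> i0} \<union> {..<i0})" by simp
    then have "finite I" by (rule rev_finite_subset) auto
    with I show False ..
  qed
  then obtain s :: "nat \<Rightarrow> nat" and D where s: "strict_mono s" "range s \<subseteq> {i \<in> I. i \<ge> i0}"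
    and D: "D \<noteq> 0" "\<And>k. det (x (s k)) = D"
    and cong: "\<And>k k' i j. D * (b11 * b22 - b12 * b21) dvd x (s k) $ i $ j - x (s k') $ i $ j"
    by (rule congruent_subsequence[OF _ b, where x = x and C = C]) (use i0 in auto)
  have sI: "s k \<in> I" and s0: "s k \<ge> i0" for k
    using s(2) by auto
  have s_top: "filterlim s at_top sequentially"
    using s(1) by (rule filterlim_subseq)
  have sym: "x (s k) $ 2 $ 1 = x (s k) $ 1 $ 2" for k
    using i0[OF s0] by simp
  have det: "x (s k) $ 1 $ 1 * x (s k) $ 2 $ 2 - x (s k) $ 1 $ 2 * x (s k) $ 1 $ 2 = D" for k
    using D(2)[of k] sym[of k] by (simp add: det_2)
  obtain l where l: "\<And>k r t. l k * x (s k + 2) $ r $ t = (x (s k + 1) ** G ** x (s k)) $ r $ t"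
    using rec[OF sI] by metis
  have entry: "(A ** G ** B) $ 1 $ t = (A $ 1 $ 1 * G $ 1 $ 1 + A $ 1 $ 2 * G $ 2 $ 1) * B $ 1 $ t
      + (A $ 1 $ 1 * G $ 1 $ 2 + A $ 1 $ 2 * G $ 2 $ 2) * B $ 2 $ t" for A B :: imat and t
    by (simp add: matrix_matrix_mult_def sum_2)
  have sub: "(\<lambda>k. f (s k)) \<longlonglongrightarrow> L" if "f \<longlonglongrightarrow> L" for f :: "nat \<Rightarrow> real" and L
    using filterlim_compose[OF that s_top] .
  have x0_s: "filterlim (\<lambda>k. \<bar>real_of_int (x (s k) $ 1 $ 1)\<bar>) at_top sequentially"
    using filterlim_compose[OF x0 s_top] .
  have R_s: "(\<lambda>k. real_of_int (x (s k) $ 1 $ 2) / of_int (x (s k) $ 1 $ 1)) \<longlonglongrightarrow> \<xi>"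
    using sub[OF R] by (simp add: R_def)
  have R_s1: "(\<lambda>k. real_of_int (x (s k + 1) $ 1 $ 2) / of_int (x (s k + 1) $ 1 $ 1)) \<longlonglongrightarrow> \<xi>"
    using sub[OF LIMSEQ_ignore_initial_segment[OF R, of 1]] by (simp add: R_def)
  have err_s: "(\<lambda>k. (real_of_int (x (s k) $ 1 $ 1))\<^sup>2 *
      (\<xi> - real_of_int (x (s k + 2) $ 1 $ 2) / real_of_int (x (s k + 2) $ 1 $ 1))) \<longlonglongrightarrow> 0"
    using sub[OF err] by (simp add: R_def)
  have ne: "x (s k + 1) $ 1 $ 1 \<noteq> 0" "x (s k + 2) $ 1 $ 1 \<noteq> 0" for k
    using i0[of "s k + 1"] i0[of "s k + 2"] s0[of k] by auto
  have rec_s: "real_of_int (l k * x (s k + 2) $ 1 $ 1) =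
      (of_int (x (s k + 1) $ 1 $ 1) * of_int (G $ 1 $ 1) + of_int (x (s k + 1) $ 1 $ 2) * of_int (G $ 2 $ 1)) * of_int (x (s k) $ 1 $ 1)
      + (of_int (x (s k + 1) $ 1 $ 1) * of_int (G $ 1 $ 2) + of_int (x (s k + 1) $ 1 $ 2) * of_int (G $ 2 $ 2)) * of_int (x (s k) $ 1 $ 2)"
    "real_of_int (l k * x (s k + 2) $ 1 $ 2) =
      (of_int (x (s k + 1) $ 1 $ 1) * of_int (G $ 1 $ 1) + of_int (x (s k + 1) $ 1 $ 2) * of_int (G $ 2 $ 1)) * of_int (x (s k) $ 1 $ 2)
      + (of_int (x (s k + 1) $ 1 $ 1) * of_int (G $ 1 $ 2) + of_int (x (s k + 1) $ 1 $ 2) * of_int (G $ 2 $ 2)) * of_int (x (s k) $ 2 $ 2)" for k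
    unfolding l entry sym by simp_all
  note lims = adjugate_limit[OF det x0_s R_s R_s1 ne err_s rec_s w[unfolded h1_def h2_def], folded h1_def h2_def]
  show ?thesis
  proof (rule approximation_transfer[OF irr \<open>D \<noteq> 0\<close> det cong cong cong x0_s R_s lims(2) lims(1) _ b \<eta>])
    show "h1 / (h1 + \<xi> * h2) + \<xi> * (h2 / (h1 + \<xi> * h2)) = 1"
      using w by (simp add: add_divide_distrib[symmetric])
    show "(of_int b11 + of_int b12 * \<eta>') * (h2 / (h1 + \<xi> * h2)) =
          (of_int b21 + of_int b22 * \<eta>') * (h1 / (h1 + \<xi> * h2))"
      using \<eta>' by simp
  qed
qed

section \<open>Comparison of the conjugates\<close>

text \<open>Both inequalities come from the same recurrence. They arise from two choices of \<open>B\<close>: the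
  rotation with rows \<open>(0, 1)\<close>, \<open>(-1, 0)\<close> takes \<open>(1, \<xi>)\<close> to a multiple of \<open>(-\<xi>, 1)\<close>, and
  \<open>B = G\<^sup>t\<close> takes \<open>(1, \<xi>)\<close> to \<open>G\<^sup>t (1, \<xi>)\<close>. Thus \<open>\<xi>\<close> has the lower Lagrange constant in the
  first case and the upper one in the second.\<close>

lemma lagrange_const_conjugates_le:
  fixes \<xi> :: real and x :: "nat \<Rightarrow> imat" and G :: imat
  defines "a \<equiv> real_of_int (G $ 1 $ 1)" and "b \<equiv> real_of_int (G $ 1 $ 2)"
    and "c \<equiv> real_of_int (G $ 2 $ 1)" and "d \<equiv> real_of_int (G $ 2 $ 2)"
  assumes irr: "\<xi> \<notin> \<rat>" and "\<not> quadratic \<xi>"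
    and seq: "assoc_sequence \<xi> x"
    and "infinite I"
    and rec: "\<And>i. i \<in> I \<Longrightarrow> x (i + 2) = x (i + 1) \<star> G \<star> x i \<or> x (i + 2) = - (x (i + 1) \<star> G \<star> x i)"
    and det: "det G \<noteq> 0" and skew: "transpose G \<noteq> - G"
  shows "\<nu> \<xi> \<le> \<nu> (- ((a + c * \<xi>) / (b + d * \<xi>)))"
    and "\<nu> (- ((a + b * \<xi>) / (c + d * \<xi>))) \<le> \<nu> \<xi>"
proof -
  have rec': "\<exists>l. \<forall>r s. l * x (i + 2) $ r $ s = (x (i + 1) ** G ** x i) $ r $ s" if "i \<in> I" for i
    using star_triple_multiple[OF rec[OF that]] by metis
  have det': "G $ 1 $ 1 * G $ 2 $ 2 - G $ 1 $ 2 * G $ 2 $ 1 \<noteq> 0"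
    using det by (simp add: det_2)
  have w: "a + \<xi> * c + \<xi> * (b + \<xi> * d) \<noteq> 0"
  proof
    assume "a + \<xi> * c + \<xi> * (b + \<xi> * d) = 0"
    then have "of_int (G $ 1 $ 1) + of_int (G $ 1 $ 2 + G $ 2 $ 1) * \<xi> + of_int (G $ 2 $ 2) * \<xi>\<^sup>2 = 0"
      by (simp add: a_def b_def c_def d_def algebra_simps power2_eq_square)
    from quadratic_relation_zero[OF irr \<open>\<not> quadratic \<xi>\<close> this]
    have "G $ 1 $ 1 = 0" "G $ 1 $ 2 = - G $ 2 $ 1" "G $ 2 $ 2 = 0"
      by auto
    then have "transpose G = - G"
      by (simp add: vec_eq_iff forall_2 transpose_def)
    with skew show False ..
  qed
  have bd: "b + d * \<xi> \<noteq> 0"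
    unfolding b_def d_def by (rule irrational_affine_ne_zero[OF irr]) (use det' in auto)
  have cd: "c + d * \<xi> \<noteq> 0"
    unfolding c_def d_def by (rule irrational_affine_ne_zero[OF irr]) (use det' in auto)
  note le = lagrange_const_le_of_recurrence[OF irr seq \<open>infinite I\<close> rec' w[unfolded a_def b_def c_def d_def],
      folded a_def b_def c_def d_def]
  show "\<nu> \<xi> \<le> \<nu> (- ((a + c * \<xi>) / (b + d * \<xi>)))"
    by (rule le[of 0 0 1 "- 1"]) (use bd in \<open>simp_all add: mult.commute[of \<xi>]\<close>)
  show "\<nu> (- ((a + b * \<xi>) / (c + d * \<xi>))) \<le> \<nu> \<xi>"
  proof (rule le[of "G $ 1 $ 1" "G $ 2 $ 2" "G $ 2 $ 1" "G $ 1 $ 2"], unfold a_def[symmetric] b_def[symmetric] c_def[symmetric] d_def[symmetric])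
    show "a + c * - ((a + b * \<xi>) / (c + d * \<xi>)) = - \<xi> * (b + d * - ((a + b * \<xi>) / (c + d * \<xi>)))"
      using cd by (simp add: field_simps)
  qed (use det' in \<open>simp_all add: mult.commute\<close>)
qed

theorem corollary5p9:
  fixes \<xi> \<xi>' \<xi>'' :: real
  assumes "extremal \<xi>"
    and "conjugates \<xi> \<xi>' \<xi>''"
  shows "\<nu> \<xi> = \<nu> \<xi>' \<and> \<nu> \<xi>' = \<nu> \<xi>''"
proof -
  have irr: "\<xi> \<notin> \<rat>" and quad: "\<not> quadratic \<xi>"
    using assms(1) by (auto simp: extremal_def)
  obtain M where M: "assoc_matrix \<xi> M"
    and \<xi>': "\<xi>' = - ((of_int (M $ 1 $ 1) + of_int (M $ 1 $ 2) * \<xi>) / (of_int (M $ 2 $ 1) + of_int (M $ 2 $ 2) * \<xi>))"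
    and \<xi>'': "\<xi>'' = - ((of_int (M $ 1 $ 1) + of_int (M $ 2 $ 1) * \<xi>) / (of_int (M $ 1 $ 2) + of_int (M $ 2 $ 2) * \<xi>))"
    using assms(2) unfolding conjugates_def Let_def by blast
  have det: "det M \<noteq> 0" and skew: "transpose M \<noteq> - M"
    using M by (auto simp: assoc_matrix_def primitive_mats_def)
  obtain x i0 where seq: "assoc_sequence \<xi> x"
    and odd_rec: "\<And>i. i \<ge> i0 \<Longrightarrow> odd i \<Longrightarrow>
      x (i + 2) = x (i + 1) \<star> M \<star> x i \<or> x (i + 2) = - (x (i + 1) \<star> M \<star> x i)"
    and even_rec: "\<And>i. i \<ge> i0 \<Longrightarrow> even i \<Longrightarrow>
      x (i + 2) = x (i + 1) \<star> transpose M \<star> x i \<or> x (i + 2) = - (x (i + 1) \<star> transpose M \<star> x i)"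
    using M unfolding assoc_matrix_def eventually_sequentially by metis
  have inf_odd: "infinite {i. i \<ge> i0 \<and> odd i}"
    unfolding infinite_nat_iff_unbounded_le
  proof
    fix m show "\<exists>n\<ge>m. n \<in> {i. i \<ge> i0 \<and> odd i}"
      by (rule exI[of _ "2 * (m + i0) + 1"]) simp
  qed
  have inf_even: "infinite {i. i \<ge> i0 \<and> even i}"
    unfolding infinite_nat_iff_unbounded_le
  proof
    fix m show "\<exists>n\<ge>m. n \<in> {i. i \<ge> i0 \<and> even i}"
      by (rule exI[of _ "2 * (m + i0)"]) simp
  qed
  have det_t: "det (transpose M) \<noteq> 0"
    using det by (simp add: det_transpose)
  have skew_t: "transpose (transpose M) \<noteq> - transpose M"
    using skew by (metis add.inverse_inverse transpose_transpose)
  have t: "transpose M $ i $ j = M $ j $ i" for i j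
    by (simp add: transpose_def)
  have "\<nu> \<xi> \<le> \<nu> \<xi>''" "\<nu> \<xi>' \<le> \<nu> \<xi>"
    unfolding \<xi>' \<xi>''
    using lagrange_const_conjugates_le[OF irr quad seq inf_odd _ det skew] odd_rec by auto
  moreover have "\<nu> \<xi> \<le> \<nu> \<xi>'" "\<nu> \<xi>'' \<le> \<nu> \<xi>"
    unfolding \<xi>' \<xi>''
    using lagrange_const_conjugates_le[OF irr quad seq inf_even _ det_t skew_t, unfolded t] even_rec by auto
  ultimately show ?thesis
    by (meson order.antisym order.trans)
qed

end
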